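(* Fix integers $n,k\ge1$. There exists a fixed matrix $\pi_{n,k}\in\mathbb Z_{\ge0}^{\mathcal H_n\times\mathcal H_n}$ such that for every $p\ge2$, every $\Lambda\in\mathfrak X_n$ and every $g\in\mathcal H_n^{(p)}$, $$C_{n,p}(\Lambda)(g)=\sum_{h\in\mathcal H_n^{(kp)}}\pi_{n,k}(\widetilde g,\widetilde h)\,C_{n,kp}(\Lambda)(h).$$ In addition, $\pi_{n,k}(\widetilde g,\widetilde h)$ is nonzero only if there exists $H\in\widetilde h$ that surjects onto some $G\in\widetilde g$ as a multigraph, and $\pi_{n,k}(\widetilde g,\widetilde g)>0$.
   Context: $\mathcal W_{[0,1]}$ is the set of symmetric measurable functions $f:[0,1]^2\to[0,1]$. $\mathfrak X_n$ is the vector space of functionals $\Lambda:\mathcal W_{[0,1]}^n\to\mathbb R$ that are multilinear (i.e. extend to a multilinear functional on $(\operatorname{span}_{\mathbb R}\mathcal W_{[0,1]})^n$), symmetric ($\Lambda(g_1,\dots,g_n)=\Lambda(g_{\tau(1)},\dots,g_{\tau(n)})$ for all $\tau\in S_n$), and $S_{[0,1]}$-invariant ($\Lambda(g_1^\sigma,\dots,g_n^\sigma)=\Lambda(g_1,\dots,g_n)$ for all Lebesgue measure-preserving bijections $\sigma$ of $[0,1]$, where $g^\sigma(x,y)=g(\sigma(x),\sigma(y))$). For $1\le a<b\le p$, $e^p_{(a,b)}=e^p_{(b,a)}$ is the indicator function of $\left(\frac{a-1}p,\frac ap\right]\times\left(\frac{b-1}p,\frac bp\right]$ plus that of $\left(\frac{b-1}p,\frac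 bp\right]\times\left(\frac{a-1}p,\frac ap\right]$, and $E_p=\{e^p_{(a,b)}:1\le a<b\le p\}$. For $x=(e^p_{(a_l,b_l)})_{l=1}^n\in E_p^n$, $\Gamma_{n,p}(x)$ is the multigraph with vertex set $\{1,\dots,p\}$ and $n$ edges, the $l$th joining $a_l$ and $b_l$. $[G]$ is the isomorphism class of $G$. Multigraphs are finite, undirected, without loops, possibly with multiple edges. A map of multigraphs $H\to G$ is a pair $V(H)\to V(G)$, $E(H)\to E(G)$ compatible with endpoints; it is surjective if both maps are. $\mathcal H_n$ is the set of isomorphism classes of multigraphs with $n$ edges and no isolated vertices; $\mathcal H_n^{(p)}$ is the set of isomorphism classes of multigraphs with $n$ edges and $p$ vertices (isolated vertices allowed). For $h\in\mathcal H_n^{(p)}$, $\widetilde h\in\mathcal H_n$ is obtained by removing isolated vertices. For $\Lambda\in\mathfrak X_n$, $p\ge2$ and $h\in\mathcal H_n^{(p)}$, $C_{n,p}(\Lambda)(h):=\Lambda(x)$ for any $x\in E_p^n$ with $[\Gamma_{n,p}(x)]=h$ (such $x$ exist and the value does not depend on the choice). *)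

theory Defs
  imports "HOL-Analysis.Analysis" "HOL-Combinatorics.Permutations"
begin

section \<open>Kernels and functionals\<close>

abbreviation unit_square :: "(real \<times> real) set" where
  "unit_square \<equiv> {0..1} \<times> {0..1}"

text \<open>A function on the unit square is represented by its extension by zero to the whole plane,
  so that pointwise linear combinations are again of this form.\<close>

definition kernels :: "(real \<times> real \<Rightarrow> real) set" where
  "kernels = {f. f \<in> borel_measurable (lebesgue_on unit_square)
     \<and> (\<forall>z\<in>unit_square. 0 \<le> f z \<and> f z \<le> 1)
     \<and> (\<forall>x y. f (x, y) = f (y, x))
     \<and> (\<forall>z. z \<notin> unit_square \<longrightarrow> f z = 0)}"

definition kernel_span :: "(real \<times> real \<Rightarrow> real) set" where
  "kernel_span = {\<lambda>z. \<Sum>w\<in>S. c w * w z | S c. finite S \<and> S \<subseteq> kernels}"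

definition kernel_tuples :: "nat \<Rightarrow> (nat \<Rightarrow> real \<times> real \<Rightarrow> real) set" where
  "kernel_tuples n = {1..n} \<rightarrow>\<^sub>E kernels"

definition kernel_span_tuples :: "nat \<Rightarrow> (nat \<Rightarrow> real \<times> real \<Rightarrow> real) set" where
  "kernel_span_tuples n = {1..n} \<rightarrow>\<^sub>E kernel_span"

definition multilinear_on_span ::
  "nat \<Rightarrow> ((nat \<Rightarrow> real \<times> real \<Rightarrow> real) \<Rightarrow> real) \<Rightarrow> bool" where
  "multilinear_on_span n M \<longleftrightarrow>
     (\<forall>g\<in>kernel_span_tuples n. \<forall>i\<in>{1..n}. \<forall>u\<in>kernel_span. \<forall>v\<in>kernel_span. \<forall>a b.
        M (g(i := (\<lambda>z. a * u z + b * v z))) = a * M (g(i := u)) + b * M (g(i := v)))"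

definition measure_preserving_bijections :: "(real \<Rightarrow> real) set" where
  "measure_preserving_bijections = {\<sigma>. bij_betw \<sigma> {0..1} {0..1}
     \<and> \<sigma> \<in> measurable (lebesgue_on {0..1}) (lebesgue_on {0..1})
     \<and> distr (lebesgue_on {0..1}) (lebesgue_on {0..1}) \<sigma> = lebesgue_on {0..1}}"

definition pullback ::
  "(real \<Rightarrow> real) \<Rightarrow> (real \<times> real \<Rightarrow> real) \<Rightarrow> real \<times> real \<Rightarrow> real" where
  "pullback \<sigma> g = (\<lambda>(x, y). if (x, y) \<in> unit_square then g (\<sigma> x, \<sigma> y) else 0)"

definition functionals :: "nat \<Rightarrow> ((nat \<Rightarrow> real \<times> real \<Rightarrow> real) \<Rightarrow> real) set" where
  "functionals n = {\<Lambda>. \<Lambda> \<in> extensional (kernel_tuples n)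
     \<and> (\<exists>M. multilinear_on_span n M \<and> (\<forall>g\<in>kernel_tuples n. M g = \<Lambda> g))
     \<and> (\<forall>\<tau>. \<tau> permutes {1..n} \<longrightarrow>
          (\<forall>g\<in>kernel_tuples n. \<Lambda> (\<lambda>i\<in>{1..n}. g (\<tau> i)) = \<Lambda> g))
     \<and> (\<forall>\<sigma>\<in>measure_preserving_bijections.
          \<forall>g\<in>kernel_tuples n. \<Lambda> (\<lambda>i\<in>{1..n}. pullback \<sigma> (g i)) = \<Lambda> g)}"

section \<open>Multigraphs\<close>

record ('v, 'e) multigraph =
  verts :: "'v set"
  edges :: "'e set"
  ends :: "'e \<Rightarrow> 'v set"

definition multigraph :: "('v, 'e) multigraph \<Rightarrow> bool" where
  "multigraph G \<longleftrightarrow> finite (verts G) \<and> finite (edges G)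
     \<and> (\<forall>e\<in>edges G. ends G e \<subseteq> verts G \<and> card (ends G e) = 2)"

definition multigraph_map ::
  "('v, 'e) multigraph \<Rightarrow> ('w, 'f) multigraph \<Rightarrow> ('v \<Rightarrow> 'w) \<Rightarrow> ('e \<Rightarrow> 'f) \<Rightarrow> bool" where
  "multigraph_map H G \<phi> \<psi> \<longleftrightarrow> \<phi> \<in> verts H \<rightarrow> verts G \<and> \<psi> \<in> edges H \<rightarrow> edges G
     \<and> (\<forall>e\<in>edges H. ends G (\<psi> e) = \<phi> ` ends H e)"

definition surjects_onto :: "('v, 'e) multigraph \<Rightarrow> ('w, 'f) multigraph \<Rightarrow> bool" where
  "surjects_onto H G \<longleftrightarrow> (\<exists>\<phi> \<psi>. multigraph_map H G \<phi> \<psi>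
     \<and> \<phi> ` verts H = verts G \<and> \<psi> ` edges H = edges G)"

definition multigraph_iso :: "('v, 'e) multigraph \<Rightarrow> ('w, 'f) multigraph \<Rightarrow> bool" where
  "multigraph_iso H G \<longleftrightarrow> (\<exists>\<phi> \<psi>. multigraph_map H G \<phi> \<psi>
     \<and> bij_betw \<phi> (verts H) (verts G) \<and> bij_betw \<psi> (edges H) (edges G))"

text \<open>Every finite multigraph has an isomorphic copy whose vertices and edges are natural numbers,
  so isomorphism classes are formed among those.\<close>

type_synonym graph = "(nat, nat) multigraph"

definition iso_class :: "graph \<Rightarrow> graph set" where
  "iso_class G = {H. multigraph H \<and> multigraph_iso G H}"

definition isolated_verts :: "('v, 'e) multigraph \<Rightarrow> 'v set" where
  "isolated_verts G = {v \<in> verts G. \<forall>e\<in>edges G. v \<notin> ends G e}"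

definition remove_isolated :: "('v, 'e) multigraph \<Rightarrow> ('v, 'e) multigraph" where
  "remove_isolated G = G\<lparr>verts := verts G - isolated_verts G\<rparr>"

definition classes :: "nat \<Rightarrow> graph set set" where
  "classes n = iso_class ` {G. multigraph G \<and> card (edges G) = n \<and> isolated_verts G = {}}"

definition classes_on :: "nat \<Rightarrow> nat \<Rightarrow> graph set set" where
  "classes_on n p = iso_class ` {G. multigraph G \<and> card (edges G) = n \<and> card (verts G) = p}"

definition reduced_class :: "graph set \<Rightarrow> graph set" where
  "reduced_class h = (\<Union>G\<in>h. iso_class (remove_isolated G))"

section \<open>Block kernels and coordinates\<close>

definition block :: "nat \<Rightarrow> nat \<Rightarrow> real set" where
  "block p a = {(real a - 1) / real p <.. real a / real p}"

definition block_kernel :: "nat \<Rightarrow> nat \<Rightarrow> nat \<Rightarrow> real \<times> real \<Rightarrow> real" where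
  "block_kernel p a b = (\<lambda>z. indicator (block p a \<times> block p b) z
                          + indicator (block p b \<times> block p a) z)"

definition block_kernels :: "nat \<Rightarrow> (real \<times> real \<Rightarrow> real) set" where
  "block_kernels p = {block_kernel p a b | a b. 1 \<le> a \<and> a < b \<and> b \<le> p}"

text \<open>The pair \<open>{a, b}\<close> is determined by the kernel, which justifies the definite description.\<close>

definition tuple_graph :: "nat \<Rightarrow> nat \<Rightarrow> (nat \<Rightarrow> real \<times> real \<Rightarrow> real) \<Rightarrow> graph" where
  "tuple_graph n p x =
     \<lparr>verts = {1..p}, edges = {1..n},
      ends = (\<lambda>l. THE s. \<exists>a b. 1 \<le> a \<and> a < b \<and> b \<le> p \<and> s = {a, b} \<and> x l = block_kernel p a b)\<rparr>"

definition coordinate ::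
  "nat \<Rightarrow> nat \<Rightarrow> ((nat \<Rightarrow> real \<times> real \<Rightarrow> real) \<Rightarrow> real) \<Rightarrow> graph set \<Rightarrow> real" where
  "coordinate n p \<Lambda> h =
     \<Lambda> (SOME x. x \<in> {1..n} \<rightarrow>\<^sub>E block_kernels p \<and> iso_class (tuple_graph n p x) = h)"

end

(* Each block of side 1/p is the union of k blocks of side 1/(kp), so a block kernel for p is a
   sum of k^2 block kernels for kp. Expanding Lambda(x) multilinearly turns it into a sum over all
   ways of lifting every edge of the graph of x to one of the finer edges above it, and grouping
   the lifts by isomorphism class gives the coefficients: pi(g, h) is the number of lifts of a
   representative of g that are isomorphic to h. The lifts do not see isolated vertices, hence
   the independence of p. A lift projects onto the graph it lifts, and lifting every vertex to
   its first copy gives the positive diagonal. The value of Lambda depends only on the isomorphism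
   class because a relabelling of the vertices is a measure-preserving permutation of the blocks. *)
theory Submission
  imports Defs
begin

section \<open>Isomorphisms of multigraphs\<close>

text \<open>The obstacle is that one coefficient must serve all \<open>p\<close>, while the classes
  in the sum have \<open>k * p\<close> vertices. Two observations remove it. Isolated vertices carry
  nothing but their number, so a class with a known number of vertices is determined by its reduced
  class, and whether a lift lies in \<open>h\<close> can be read off \<open>reduced_class h\<close>.
  And a lift lives only over vertices that meet an edge, so the sub-blocks can be renamed as pairs
  \<open>(v, i)\<close> with \<open>i < k\<close> over a representative of the reduced class, where
  no \<open>p\<close> is left.

  No loops arise: an edge joins two different blocks, so a finer pair above it also consists of two
  different blocks. Squares on the diagonal therefore never enter the expansion.

  Linearity is available only for some extension \<open>M\<close> of the functional to the span, so
  the expansion is carried out with \<open>M\<close>; the first and the last tuples consist of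
  kernels, where both agree.\<close>

lemma multigraph_isoI:
  assumes "bij_betw \<phi> (verts G) (verts H)" "bij_betw \<psi> (edges G) (edges H)"
    and "\<And>e. e \<in> edges G \<Longrightarrow> ends H (\<psi> e) = \<phi> ` ends G e"
  shows "multigraph_iso G H"
  unfolding multigraph_iso_def multigraph_map_def
  using assms bij_betwE[OF assms(1)] bij_betwE[OF assms(2)]
  by (intro exI[of _ \<phi>] exI[of _ \<psi>]) auto

lemma multigraph_isoE:
  assumes "multigraph_iso G H"
  obtains \<phi> \<psi> where "bij_betw \<phi> (verts G) (verts H)" "bij_betw \<psi> (edges G) (edges H)"
    "\<And>e. e \<in> edges G \<Longrightarrow> ends H (\<psi> e) = \<phi> ` ends G e"
  using assms unfolding multigraph_iso_def multigraph_map_def by blast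

lemma multigraph_iso_refl: "multigraph_iso G G"
  by (rule multigraph_isoI[of id _ _ id]) auto

text \<open>The hypothesis on \<open>G\<close> puts the ends of every edge inside
  \<open>verts G\<close>, where \<open>inv_into\<close> is known to undo the vertex
  bijection.\<close>

lemma multigraph_iso_sym:
  assumes "multigraph G" "multigraph_iso G H"
  shows "multigraph_iso H G"
proof -
  obtain \<phi> \<psi> where *: "bij_betw \<phi> (verts G) (verts H)" "bij_betw \<psi> (edges G) (edges H)"
    "\<And>e. e \<in> edges G \<Longrightarrow> ends H (\<psi> e) = \<phi> ` ends G e"
    using multigraph_isoE[OF assms(2)] by blast
  show ?thesis
  proof (rule multigraph_isoI)
    show "bij_betw (inv_into (verts G) \<phi>) (verts H) (verts G)"
      "bij_betw (inv_into (edges G) \<psi>) (edges H) (edges G)"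
      using * by (auto intro: bij_betw_inv_into)
    fix e assume e: "e \<in> edges H"
    define e' where "e' = inv_into (edges G) \<psi> e"
    have e': "e' \<in> edges G" "\<psi> e' = e"
      using e *(2) unfolding e'_def
      by (simp_all add: bij_betw_def f_inv_into_f inv_into_into)
    have "ends G e' \<subseteq> verts G"
      using assms(1) e'(1) by (simp add: multigraph_def)
    then show "ends G (inv_into (edges G) \<psi> e) = inv_into (verts G) \<phi> ` ends H e"
      using *(1) *(3)[OF e'(1)] e' unfolding e'_def[symmetric]
      by (simp add: bij_betw_def)
  qed
qed

lemma multigraph_iso_trans:
  assumes "multigraph_iso G H" "multigraph_iso H K"
  shows "multigraph_iso G K"
proof -
  obtain \<phi> \<psi> where 1: "bij_betw \<phi> (verts G) (verts H)" "bij_betw \<psi> (edges G) (edges H)"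
    "\<And>e. e \<in> edges G \<Longrightarrow> ends H (\<psi> e) = \<phi> ` ends G e"
    using multigraph_isoE[OF assms(1)] by blast
  obtain \<phi>' \<psi>' where 2: "bij_betw \<phi>' (verts H) (verts K)" "bij_betw \<psi>' (edges H) (edges K)"
    "\<And>e. e \<in> edges H \<Longrightarrow> ends K (\<psi>' e) = \<phi>' ` ends H e"
    using multigraph_isoE[OF assms(2)] by blast
  show ?thesis
  proof (rule multigraph_isoI)
    show "bij_betw (\<phi>' \<circ> \<phi>) (verts G) (verts K)" "bij_betw (\<psi>' \<circ> \<psi>) (edges G) (edges K)"
      using 1 2 by (auto intro: bij_betw_trans)
    fix e assume "e \<in> edges G"
    moreover from this have "\<psi> e \<in> edges H" using 1(2) bij_betwE by blast
    ultimately show "ends K ((\<psi>' \<circ> \<psi>) e) = (\<phi>' \<circ> \<phi>) ` ends G e"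
      using 1(3) 2(3) by (simp add: image_comp)
  qed
qed

lemma iso_class_eq_iff:
  assumes "multigraph G" "multigraph H"
  shows "iso_class G = iso_class H \<longleftrightarrow> multigraph_iso G H"
proof
  assume "iso_class G = iso_class H"
  then have "H \<in> iso_class G"
    using assms multigraph_iso_refl by (auto simp: iso_class_def)
  then show "multigraph_iso G H" by (simp add: iso_class_def)
next
  assume "multigraph_iso G H"
  then show "iso_class G = iso_class H"
    using multigraph_iso_trans multigraph_iso_sym[OF assms(1)]
    unfolding iso_class_def by blast
qed

lemma iso_class_mem:
  assumes "multigraph G" "H \<in> iso_class G"
  shows "multigraph H" "multigraph_iso G H" "iso_class H = iso_class G"
  using assms iso_class_eq_iff[of G H] by (auto simp: iso_class_def)

lemma iso_class_self: "multigraph G \<Longrightarrow> G \<in> iso_class G"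
  by (simp add: iso_class_def multigraph_iso_refl)

lemma multigraph_iso_card:
  assumes "multigraph_iso G H"
  shows "card (verts G) = card (verts H)" "card (edges G) = card (edges H)"
  using assms by (auto elim!: multigraph_isoE dest: bij_betw_same_card)

lemma verts_remove_isolated:
  assumes "multigraph G"
  shows "verts (remove_isolated G) = \<Union> (ends G ` edges G)"
  using assms by (auto simp: remove_isolated_def isolated_verts_def multigraph_def)

lemma remove_isolated_simps [simp]:
  "edges (remove_isolated G) = edges G" "ends (remove_isolated G) = ends G"
  by (simp_all add: remove_isolated_def)

lemma multigraph_remove_isolated:
  assumes "multigraph G"
  shows "multigraph (remove_isolated G)"
  using assms unfolding multigraph_def
  by (auto simp: remove_isolated_def isolated_verts_def)

lemma remove_isolated_iso:
  assumes "multigraph G" "multigraph H" "multigraph_iso G H"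
  shows "multigraph_iso (remove_isolated G) (remove_isolated H)"
proof -
  obtain \<phi> \<psi> where *: "bij_betw \<phi> (verts G) (verts H)" "bij_betw \<psi> (edges G) (edges H)"
    "\<And>e. e \<in> edges G \<Longrightarrow> ends H (\<psi> e) = \<phi> ` ends G e"
    using multigraph_isoE[OF assms(3)] by blast
  show ?thesis
  proof (rule multigraph_isoI)
    have "\<phi> ` \<Union> (ends G ` edges G) = \<Union> (ends H ` \<psi> ` edges G)"
      using *(3) by (simp add: image_UN)
    also have "\<psi> ` edges G = edges H"
      using *(2) by (simp add: bij_betw_def)
    finally have "\<phi> ` verts (remove_isolated G) = verts (remove_isolated H)"
      using assms by (simp add: verts_remove_isolated)
    moreover have "verts (remove_isolated G) \<subseteq> verts G"
      by (auto simp: remove_isolated_def)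
    ultimately show "bij_betw \<phi> (verts (remove_isolated G)) (verts (remove_isolated H))"
      using *(1) bij_betw_subset by blast
  qed (use * in auto)
qed

text \<open>Equal totals leave equally many isolated vertices on both sides, and any bijection
  between those extends the given isomorphism, since no edge sees them.\<close>

lemma iso_if_remove_isolated_iso:
  assumes "multigraph G" "multigraph H" "card (verts G) = card (verts H)"
    and "multigraph_iso (remove_isolated G) (remove_isolated H)"
  shows "multigraph_iso G H"
proof -
  define U U' where "U = verts (remove_isolated G)" and "U' = verts (remove_isolated H)"
  obtain \<phi> \<psi> where *: "bij_betw \<phi> U U'" "bij_betw \<psi> (edges G) (edges H)"
    "\<And>e. e \<in> edges G \<Longrightarrow> ends H (\<psi> e) = \<phi> ` ends G e"
    using multigraph_isoE[OF assms(4)] unfolding U_def U'_def by auto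
  have sub: "U \<subseteq> verts G" "U' \<subseteq> verts H"
    by (auto simp: U_def U'_def remove_isolated_def)
  have fin: "finite (verts G)" "finite (verts H)"
    using assms by (auto simp: multigraph_def)
  have "card (verts G - U) = card (verts H - U')"
    using sub fin assms(3) bij_betw_same_card[OF *(1)]
    by (simp add: card_Diff_subset finite_subset)
  then obtain \<theta> where \<theta>: "bij_betw \<theta> (verts G - U) (verts H - U')"
    using fin by (meson finite_Diff finite_same_card_bij)
  show ?thesis
  proof (rule multigraph_isoI)
    have "bij_betw (\<lambda>v. if v \<in> U then \<phi> v else \<theta> v) (U \<union> (verts G - U)) (U' \<union> (verts H - U'))"
      by (rule bij_betw_disjoint_Un[OF *(1) \<theta>]) auto
    then show "bij_betw (\<lambda>v. if v \<in> U then \<phi> v else \<theta> v) (verts G) (verts H)"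
      using sub by (simp add: Un_absorb1)
    fix e assume e: "e \<in> edges G"
    then have "ends G e \<subseteq> U"
      using assms(1) by (auto simp: U_def verts_remove_isolated)
    then show "ends H (\<psi> e) = (\<lambda>v. if v \<in> U then \<phi> v else \<theta> v) ` ends G e"
      using *(3)[OF e] by (auto simp: image_iff subset_iff)
  qed (use * in auto)
qed

text \<open>All members of a class have isomorphic reductions, so the union in
  \<open>reduced_class\<close> is a union of copies of one class.\<close>

lemma reduced_class_iso_class:
  assumes "multigraph G"
  shows "reduced_class (iso_class G) = iso_class (remove_isolated G)"
proof -
  have "iso_class (remove_isolated H) = iso_class (remove_isolated G)" if "H \<in> iso_class G" for H
    using iso_class_mem[OF assms that] assms
    by (metis iso_class_eq_iff multigraph_remove_isolated remove_isolated_iso)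
  then show ?thesis
    using iso_class_self[OF assms] unfolding reduced_class_def by blast
qed

section \<open>Labelled normal forms of isomorphism classes\<close>

definition vertex_pairs :: "nat \<Rightarrow> nat set set" where
  "vertex_pairs m = {s. s \<subseteq> {1..m} \<and> card s = 2}"

text \<open>With vertices and edges numbered, a graph is just its map \<open>L\<close> from edges to
  pairs, which is also the data of a tuple of block kernels.\<close>

definition labelled_graph :: "nat \<Rightarrow> nat \<Rightarrow> (nat \<Rightarrow> nat set) \<Rightarrow> graph" where
  "labelled_graph n m L = \<lparr>verts = {1..m}, edges = {1..n}, ends = L\<rparr>"

lemma finite_vertex_pairs: "finite (vertex_pairs m)"
  by (rule finite_subset[of _ "Pow {1..m}"]) (auto simp: vertex_pairs_def)

lemma multigraph_labelled_graph:
  "L \<in> {1..n} \<rightarrow> vertex_pairs m \<Longrightarrow> multigraph (labelled_graph n m L)"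
  by (auto simp: multigraph_def labelled_graph_def vertex_pairs_def Pi_iff)

lemma labelled_graph_class:
  "L \<in> {1..n} \<rightarrow> vertex_pairs m \<Longrightarrow> iso_class (labelled_graph n m L) \<in> classes_on n m"
  using multigraph_labelled_graph[of L n m]
  by (auto simp: classes_on_def labelled_graph_def)

lemma classes_onE:
  assumes "h \<in> classes_on n m"
  obtains L where "L \<in> {1..n} \<rightarrow>\<^sub>E vertex_pairs m" "h = iso_class (labelled_graph n m L)"
proof -
  obtain G where G: "multigraph G" "card (edges G) = n" "card (verts G) = m" "h = iso_class G"
    using assms by (auto simp: classes_on_def)
  have fin: "finite (verts G)" "finite (edges G)"
    using G(1) by (auto simp: multigraph_def)
  obtain \<phi> where \<phi>: "bij_betw \<phi> (verts G) {1..m}"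
    using finite_same_card_bij[OF fin(1), of "{1..m}"] G(3) by auto
  obtain \<psi> where \<psi>: "bij_betw \<psi> {1..n} (edges G)"
    using finite_same_card_bij[OF _ fin(2), of "{1..n}"] G(2) by auto
  define L where "L = (\<lambda>l\<in>{1..n}. \<phi> ` ends G (\<psi> l))"
  have L: "L \<in> {1..n} \<rightarrow>\<^sub>E vertex_pairs m"
  proof
    fix l assume l: "l \<in> {1..n}"
    then have "\<psi> l \<in> edges G" using \<psi> bij_betwE by blast
    then have *: "ends G (\<psi> l) \<subseteq> verts G" "card (ends G (\<psi> l)) = 2"
      using G(1) by (auto simp: multigraph_def)
    then have "card (\<phi> ` ends G (\<psi> l)) = 2"
      using \<phi> by (metis bij_betw_def card_image inj_on_subset)
    moreover have "\<phi> ` ends G (\<psi> l) \<subseteq> {1..m}"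
      using * \<phi> by (auto simp: bij_betw_def)
    ultimately show "L l \<in> vertex_pairs m"
      using l by (simp add: L_def vertex_pairs_def)
  qed (auto simp: L_def)
  have "multigraph_iso (labelled_graph n m L) G"
  proof (rule multigraph_isoI)
    show "bij_betw (inv_into (verts G) \<phi>) (verts (labelled_graph n m L)) (verts G)"
      using \<phi> by (simp add: labelled_graph_def bij_betw_inv_into)
    show "bij_betw \<psi> (edges (labelled_graph n m L)) (edges G)"
      using \<psi> by (simp add: labelled_graph_def)
    fix l assume "l \<in> edges (labelled_graph n m L)"
    then have l: "l \<in> {1..n}" by (simp add: labelled_graph_def)
    then have "\<psi> l \<in> edges G" using \<psi> bij_betwE by blast
    then have *: "ends G (\<psi> l) \<subseteq> verts G"
      using G(1) by (auto simp: multigraph_def)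
    then show "ends G (\<psi> l) = inv_into (verts G) \<phi> ` ends (labelled_graph n m L) l"
      using l \<phi> by (simp add: labelled_graph_def L_def bij_betw_def)
  qed
  moreover have "multigraph (labelled_graph n m L)"
    using L by (auto intro!: multigraph_labelled_graph)
  ultimately have "h = iso_class (labelled_graph n m L)"
    using G iso_class_eq_iff by metis
  then show ?thesis using L that by blast
qed

text \<open>Needed to regroup the sum over lifts as a sum over classes.\<close>

lemma finite_classes_on: "finite (classes_on n m)"
proof (rule finite_subset)
  show "classes_on n m \<subseteq> (\<lambda>L. iso_class (labelled_graph n m L)) ` ({1..n} \<rightarrow>\<^sub>E vertex_pairs m)"
    by (auto elim!: classes_onE)
  show "finite ((\<lambda>L. iso_class (labelled_graph n m L)) ` ({1..n} \<rightarrow>\<^sub>E vertex_pairs m))"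
    by (intro finite_imageI finite_PiE finite_vertex_pairs) auto
qed

section \<open>Lifts of edges\<close>

text \<open>For a projection \<open>q\<close> whose fibres are the sub-blocks of each block, an edge lift chooses one
  of the finer edges above every edge. The graph a lift generates has no isolated vertices, so
  it does not depend on the number of blocks.\<close>

definition edge_lifts :: "('w \<Rightarrow> 'v) \<Rightarrow> 'w set \<Rightarrow> ('v, 'e) multigraph \<Rightarrow> ('e \<Rightarrow> 'w set) set" where
  "edge_lifts q W G = (\<Pi>\<^sub>E e\<in>edges G. {s. s \<subseteq> W \<and> card s = 2 \<and> q ` s = ends G e})"

definition spanned_graph :: "'e set \<Rightarrow> ('e \<Rightarrow> 'w set) \<Rightarrow> ('w, 'e) multigraph" where
  "spanned_graph E L = \<lparr>verts = \<Union> (L ` E), edges = E, ends = L\<rparr>"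

lemma finite_edge_lifts: "finite (edges G) \<Longrightarrow> finite W \<Longrightarrow> finite (edge_lifts q W G)"
  unfolding edge_lifts_def
  by (intro finite_PiE) (auto intro: finite_subset[of _ "Pow W"])

lemma edge_liftsD:
  assumes "L \<in> edge_lifts q W G" "e \<in> edges G"
  shows "L e \<subseteq> W" "card (L e) = 2" "q ` L e = ends G e"
  using assms by (auto simp: edge_lifts_def PiE_iff)

lemma multigraph_spanned_graph:
  assumes "finite E" "\<And>e. e \<in> E \<Longrightarrow> card (L e) = 2"
  shows "multigraph (spanned_graph E L)"
proof -
  have "finite (L e)" if "e \<in> E" for e
    using assms(2)[OF that] card.infinite by fastforce
  then show ?thesis
    using assms by (auto simp: multigraph_def spanned_graph_def)
qed

lemma remove_isolated_labelled_graph: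
  assumes "L \<in> {1..n} \<rightarrow> vertex_pairs m"
  shows "remove_isolated (labelled_graph n m L) = spanned_graph {1..n} L"
  using verts_remove_isolated[OF multigraph_labelled_graph[OF assms]]
  by (intro multigraph.equality) (auto simp: spanned_graph_def labelled_graph_def)

text \<open>A vertex map that commutes with the projections pushes lifts forward and keeps their
  isomorphism type. It has to be injective only over vertices that meet an edge, so isolated
  vertices may be present on one side and absent on the other. Applied in both directions, the
  inequality gives equality.\<close>

lemma card_edge_lifts_le:
  fixes G :: "('v, 'e) multigraph" and G' :: "('v', 'f) multigraph"
  assumes \<psi>: "bij_betw \<psi> (edges G) (edges G')"
    and ends: "\<And>e. e \<in> edges G \<Longrightarrow> ends G' (\<psi> e) = \<phi> ` ends G e"
    and inj: "inj_on \<Phi> {w \<in> W. q w \<in> \<Union> (ends G ` edges G)}"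
    and img: "\<And>w. w \<in> W \<Longrightarrow> q w \<in> \<Union> (ends G ` edges G) \<Longrightarrow> \<Phi> w \<in> W' \<and> q' (\<Phi> w) = \<phi> (q w)"
    and fin: "finite (edges G')" "finite W'"
  shows "card {L \<in> edge_lifts q W G. multigraph_iso (spanned_graph (edges G) L) H}
       \<le> card {L \<in> edge_lifts q' W' G'. multigraph_iso (spanned_graph (edges G') L) H}"
proof (rule card_inj_on_le)
  define W0 where "W0 = {w \<in> W. q w \<in> \<Union> (ends G ` edges G)}"
  define \<psi>' where "\<psi>' = inv_into (edges G) \<psi>"
  \<comment> \<open>The pushed-forward lift: edges are renamed by \<psi>, their finer ends by
    \<Phi>.\<close>
  define F where "F L = (\<lambda>e\<in>edges G'. \<Phi> ` L (\<psi>' e))" for L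
  have \<psi>': "\<psi>' e \<in> edges G" "\<psi> (\<psi>' e) = e" if "e \<in> edges G'" for e
    using that \<psi> unfolding \<psi>'_def by (auto simp: bij_betw_def f_inv_into_f inv_into_into)
  have \<psi>'\<psi>: "\<psi>' (\<psi> e) = e" "\<psi> e \<in> edges G'" if "e \<in> edges G" for e
    using that \<psi> unfolding \<psi>'_def by (auto simp: bij_betw_def)
  have sub: "L e \<subseteq> W0" if "L \<in> edge_lifts q W G" "e \<in> edges G" for L e
    using edge_liftsD[OF that] that(2) unfolding W0_def by blast
  have injW0: "inj_on \<Phi> W0" using inj by (simp add: W0_def)
  show "inj_on F {L \<in> edge_lifts q W G. multigraph_iso (spanned_graph (edges G) L) H}"
  proof (rule inj_onI, clarify)
    fix L L' assume *: "L \<in> edge_lifts q W G" "L' \<in> edge_lifts q W G" "F L = F L'"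
    have "L e = L' e" if e: "e \<in> edges G" for e
    proof -
      have "F L (\<psi> e) = F L' (\<psi> e)" using *(3) by simp
      then have "\<Phi> ` L e = \<Phi> ` L' e" using \<psi>'\<psi>[OF e] by (simp add: F_def)
      then show ?thesis
        using inj_on_image_eq_iff[OF injW0] sub[OF *(1) e] sub[OF *(2) e] by simp
    qed
    then show "L = L'"
      using *(1,2) unfolding edge_lifts_def by (blast intro: PiE_ext)
  qed
  show "F ` {L \<in> edge_lifts q W G. multigraph_iso (spanned_graph (edges G) L) H}
      \<subseteq> {L \<in> edge_lifts q' W' G'. multigraph_iso (spanned_graph (edges G') L) H}"
  proof clarify
    fix L assume L: "L \<in> edge_lifts q W G"
      and iso: "multigraph_iso (spanned_graph (edges G) L) H"
    have lift: "\<Phi> ` L e \<subseteq> W'" "card (\<Phi> ` L e) = 2" "q' ` \<Phi> ` L e = ends G' (\<psi> e)"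
      if e: "e \<in> edges G" for e
    proof -
      note D = edge_liftsD[OF L e]
      show "\<Phi> ` L e \<subseteq> W'"
        using sub[OF L e] img unfolding W0_def by blast
      show "card (\<Phi> ` L e) = 2"
        using card_image[OF inj_on_subset[OF injW0 sub[OF L e]]] D(2) by simp
      have "q' ` \<Phi> ` L e = \<phi> ` q ` L e"
        unfolding image_image using sub[OF L e] img unfolding W0_def
        by (intro image_cong) auto
      then show "q' ` \<Phi> ` L e = ends G' (\<psi> e)"
        using D(3) ends[OF e] by simp
    qed
    have FL: "F L \<in> edge_lifts q' W' G'"
      unfolding edge_lifts_def
    proof
      fix e assume e: "e \<in> edges G'"
      then show "F L e \<in> {s. s \<subseteq> W' \<and> card s = 2 \<and> q' ` s = ends G' e}"
        using lift[OF \<psi>'(1)[OF e]] \<psi>'(2)[OF e] by (simp add: F_def)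
    qed (simp add: F_def)
    have "multigraph_iso (spanned_graph (edges G) L) (spanned_graph (edges G') (F L))"
    proof (rule multigraph_isoI)
      have F\<psi>: "F L (\<psi> e) = \<Phi> ` L e" if "e \<in> edges G" for e
        using \<psi>'\<psi>[OF that] by (simp add: F_def)
      have "edges G' = \<psi> ` edges G"
        using \<psi> by (simp add: bij_betw_def)
      then have "\<Union> (F L ` edges G') = (\<Union>e\<in>edges G. F L (\<psi> e))"
        by (simp only: image_image)
      also have "\<dots> = \<Phi> ` \<Union> (L ` edges G)"
        using F\<psi> by (simp add: image_UN)
      finally show "bij_betw \<Phi> (verts (spanned_graph (edges G) L))
          (verts (spanned_graph (edges G') (F L)))"
        using inj_on_subset[OF injW0] sub[OF L]
        by (auto simp: spanned_graph_def bij_betw_def UN_subset_iff)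
      show "bij_betw \<psi> (edges (spanned_graph (edges G) L)) (edges (spanned_graph (edges G') (F L)))"
        using \<psi> by (simp add: spanned_graph_def)
    qed (use \<psi>'\<psi> in \<open>auto simp: spanned_graph_def F_def\<close>)
    moreover have "multigraph (spanned_graph (edges G) L)"
      using edge_liftsD(2)[OF L] fin \<psi>
      by (auto intro!: multigraph_spanned_graph simp: bij_betw_finite)
    ultimately have "multigraph_iso (spanned_graph (edges G') (F L)) H"
      using iso multigraph_iso_sym multigraph_iso_trans by blast
    with FL show "F L \<in> edge_lifts q' W' G' \<and> multigraph_iso (spanned_graph (edges G') (F L)) H"
      by simp
  qed
  show "finite {L \<in> edge_lifts q' W' G'. multigraph_iso (spanned_graph (edges G') L) H}"
    using finite_edge_lifts[OF fin] by simp
qed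

section \<open>Block kernels and permutations of blocks\<close>

text \<open>Blocks are open on the left and closed on the right, so rounding up finds the block of a
  point; \<open>nat\<close> sends every nonpositive point to 0, which is no block number.\<close>

definition block_index :: "nat \<Rightarrow> real \<Rightarrow> nat" where
  "block_index m x = nat \<lceil>real m * x\<rceil>"

lemma mem_block_iff:
  assumes "m > 0" "a \<ge> 1"
  shows "x \<in> block m a \<longleftrightarrow> block_index m x = a"
proof -
  have "x \<in> block m a \<longleftrightarrow> real a - 1 < real m * x \<and> real m * x \<le> real a"
    using assms by (auto simp: block_def field_simps)
  also have "\<dots> \<longleftrightarrow> \<lceil>real m * x\<rceil> = int a"
    by (simp add: ceiling_eq_iff)
  also have "\<dots> \<longleftrightarrow> block_index m x = a"
    using assms by (auto simp: block_index_def)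
  finally show ?thesis .
qed

lemma block_index_range:
  assumes "m > 0"
  shows "block_index m x \<in> {1..m} \<longleftrightarrow> 0 < x \<and> x \<le> 1"
proof -
  have "block_index m x \<le> m \<longleftrightarrow> x \<le> 1"
    using assms by (simp add: block_index_def)
  moreover have "block_index m x \<ge> 1 \<longleftrightarrow> 0 < x"
    using assms by (simp add: block_index_def Suc_le_eq zero_less_mult_iff)
  ultimately show ?thesis by auto
qed

lemma block_index_divide:
  assumes "m > 0"
  shows "block_index m (real a / real m) = a"
  using assms by (simp add: block_index_def)

section \<open>Passing from fine to coarse block numbers\<close>

definition coarse_index :: "nat \<Rightarrow> nat \<Rightarrow> nat" where
  "coarse_index k w = (w + k - 1) div k"

text \<open>The adjunction between rounding up a quotient by \<open>k\<close> and multiplying by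
  \<open>k\<close>. Later facts identify coarse indices through their upper bounds and need no
  further computation with \<open>div\<close>.\<close>

lemma coarse_index_le_iff:
  assumes "k \<ge> 1"
  shows "coarse_index k w \<le> a \<longleftrightarrow> w \<le> k * a"
proof -
  have "coarse_index k w \<le> a \<longleftrightarrow> w + k - 1 < Suc a * k"
    using assms by (simp add: coarse_index_def less_mult_imp_div_less div_less_iff_less_mult flip: less_Suc_eq_le)
  then show ?thesis using assms by (auto simp: algebra_simps)
qed

lemma coarse_index_eq_iff:
  assumes "k \<ge> 1" "v \<ge> 1"
  shows "coarse_index k w = v \<longleftrightarrow> (\<exists>i<k. w = k * (v - 1) + i + 1)"
proof -
  have "coarse_index k w = v \<longleftrightarrow> coarse_index k w \<le> v \<and> \<not> coarse_index k w \<le> v - 1"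
    using assms by auto
  also have "\<dots> \<longleftrightarrow> k * (v - 1) < w \<and> w \<le> k * (v - 1) + k"
    using assms by (auto simp: coarse_index_le_iff algebra_simps)
  also have "\<dots> \<longleftrightarrow> (\<exists>i<k. w = k * (v - 1) + i + 1)"
  proof
    assume "k * (v - 1) < w \<and> w \<le> k * (v - 1) + k"
    then show "\<exists>i<k. w = k * (v - 1) + i + 1"
      by (intro exI[of _ "w - k * (v - 1) - 1"]) auto
  qed auto
  finally show ?thesis .
qed

text \<open>Both sides have the same upper bounds \<open>a\<close>, namely those with
  \<open>p * x \<le> a\<close>.\<close>

lemma coarse_index_block_index:
  assumes "k \<ge> 1"
  shows "coarse_index k (block_index (k * p) x) = block_index p x"
proof -
  have "coarse_index k (block_index (k * p) x) \<le> a \<longleftrightarrow> block_index p x \<le> a" for a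
    using assms by (simp add: coarse_index_le_iff block_index_def mult.assoc)
  then show ?thesis by (meson order.antisym order.refl)
qed

section \<open>Block kernels indexed by unordered pairs\<close>

definition pair_kernel :: "nat \<Rightarrow> nat set \<Rightarrow> real \<times> real \<Rightarrow> real" where
  "pair_kernel m s = (\<lambda>(x, y). of_bool ({block_index m x, block_index m y} = s))"

text \<open>For distinct blocks the two mirrored rectangles are disjoint, so their indicators never
  add up to 2 and the sum is a condition on the unordered pair of indices.\<close>

lemma block_kernel_eq_pair_kernel:
  assumes "m > 0" "a \<ge> 1" "b \<ge> 1" "a \<noteq> b"
  shows "block_kernel m a b = pair_kernel m {a, b}"
  using assms mem_block_iff[of m a] mem_block_iff[of m b]
  by (auto simp: fun_eq_iff block_kernel_def pair_kernel_def indicator_def doubleton_eq_iff)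

lemma vertex_pairs_iff:
  "s \<in> vertex_pairs m \<longleftrightarrow> (\<exists>a b. 1 \<le> a \<and> a < b \<and> b \<le> m \<and> s = {a, b})"
proof
  assume s: "s \<in> vertex_pairs m"
  then obtain a b where ab: "s = {a, b}" "a \<noteq> b"
    by (auto simp: vertex_pairs_def card_2_iff)
  then have "s = {min a b, max a b}" "min a b < max a b" "1 \<le> min a b" "max a b \<le> m"
    using s by (auto simp: vertex_pairs_def min_def max_def)
  then show "\<exists>a b. 1 \<le> a \<and> a < b \<and> b \<le> m \<and> s = {a, b}" by blast
qed (auto simp: vertex_pairs_def)

lemma vertex_pairsE:
  assumes "s \<in> vertex_pairs m"
  obtains a b where "1 \<le> a" "a < b" "b \<le> m" "m > 0" "s = {a, b}"
  using assms unfolding vertex_pairs_iff by force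

lemma block_kernels_eq: "block_kernels m = pair_kernel m ` vertex_pairs m"
proof (rule set_eqI)
  fix f
  have eq: "block_kernel m a b = pair_kernel m {a, b}" if "1 \<le> a" "a < b" "b \<le> m" for a b
    using that by (intro block_kernel_eq_pair_kernel) auto
  have "f \<in> block_kernels m \<longleftrightarrow> (\<exists>a b. 1 \<le> a \<and> a < b \<and> b \<le> m \<and> f = pair_kernel m {a, b})"
    unfolding block_kernels_def mem_Collect_eq by (intro ex_cong1) (auto simp: eq)
  also have "\<dots> \<longleftrightarrow> f \<in> pair_kernel m ` vertex_pairs m"
    unfolding image_iff Bex_def vertex_pairs_iff by blast
  finally show "f \<in> block_kernels m \<longleftrightarrow> f \<in> pair_kernel m ` vertex_pairs m" .
qed

lemma inj_on_pair_kernel: "inj_on (pair_kernel m) (vertex_pairs m)"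
proof (rule inj_onI)
  fix s t assume st: "s \<in> vertex_pairs m" "t \<in> vertex_pairs m" "pair_kernel m s = pair_kernel m t"
  obtain a b where ab: "s = {a, b}" "m > 0" using st(1) by (rule vertex_pairsE)
  \<comment> \<open>The right endpoint of a block belongs to it, so this point has indices
    \<open>a\<close> and \<open>b\<close>, and evaluating there reads the pair off the
    kernel.\<close>
  have "pair_kernel m t (real a / real m, real b / real m) = 1"
    using ab by (simp flip: st(3)) (simp add: pair_kernel_def block_index_divide)
  then show "s = t" using ab by (simp add: pair_kernel_def block_index_divide)
qed

lemma pair_kernel_outside:
  assumes "s \<in> vertex_pairs m" "z \<notin> unit_square"
  shows "pair_kernel m s z = 0"
proof -
  obtain x y where z: "z = (x, y)" by fastforce
  have "m > 0" using assms(1) by (rule vertex_pairsE)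
  then have "block_index m x \<notin> {1..m} \<or> block_index m y \<notin> {1..m}"
    using assms(2) unfolding z block_index_range[OF \<open>m > 0\<close>] by auto
  then show ?thesis
    using assms(1) z by (auto simp: pair_kernel_def vertex_pairs_def)
qed

lemma pair_kernel_in_kernels:
  assumes s: "s \<in> vertex_pairs m"
  shows "pair_kernel m s \<in> kernels"
proof -
  obtain a b where ab: "1 \<le> a" "a < b" "m > 0" "s = {a, b}" using s by (rule vertex_pairsE)
  have eq: "pair_kernel m s = block_kernel m a b"
    using ab by (simp add: block_kernel_eq_pair_kernel)
  have "block m c \<times> block m d \<in> sets borel" for c d
    unfolding borel_prod[symmetric] by (intro pair_measureI) (auto simp: block_def)
  then have "block_kernel m a b \<in> borel_measurable borel"
    unfolding block_kernel_def by (intro borel_measurable_add borel_measurable_indicator)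
  then have "pair_kernel m s \<in> borel_measurable (lebesgue_on unit_square)"
    unfolding eq by (intro measurable_restrict_space1 measurable_completion) simp
  moreover have "pair_kernel m s (x, y) = pair_kernel m s (y, x)" for x y
    by (simp add: pair_kernel_def insert_commute)
  moreover have "0 \<le> pair_kernel m s z \<and> pair_kernel m s z \<le> 1" for z
    by (simp add: pair_kernel_def split: prod.split)
  ultimately show ?thesis
    using pair_kernel_outside[OF s] unfolding kernels_def by blast
qed

text \<open>At a point with fine indices \<open>i\<close> and \<open>j\<close> only the summand of
  \<open>{i, j}\<close> can be nonzero, so the claim reduces to whether this pair lies above
  \<open>e\<close>.\<close>

lemma pair_kernel_refine:
  assumes "k \<ge> 1" "e \<in> vertex_pairs p"
  shows "pair_kernel p e
       = (\<lambda>z. \<Sum>s\<in>{s \<in> vertex_pairs (k * p). coarse_index k ` s = e}. pair_kernel (k * p) s z)"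
proof
  fix z :: "real \<times> real"
  obtain x y where z: "z = (x, y)" by fastforce
  define i j where "i = block_index (k * p) x" and "j = block_index (k * p) y"
  define S where "S = {s \<in> vertex_pairs (k * p). coarse_index k ` s = e}"
  have fin: "finite S" using finite_vertex_pairs by (simp add: S_def)
  have mem: "{i, j} \<in> S \<longleftrightarrow> {coarse_index k i, coarse_index k j} = e"
  proof
    assume e: "{coarse_index k i, coarse_index k j} = e"
    \<comment> \<open>The bound \<open>p\<close> gives the upper end, and the bound 0 excludes
      \<open>w = 0\<close>.\<close>
    have "w \<in> {1..k * p}" if "coarse_index k w \<in> {1..p}" for w
      using that coarse_index_le_iff[OF assms(1), of w p] coarse_index_le_iff[OF assms(1), of w 0]
      by auto
    moreover have "coarse_index k i \<in> {1..p}" "coarse_index k j \<in> {1..p}"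
      using assms(2) e by (auto simp: vertex_pairs_def)
    \<comment> \<open>Equal fine indices would have one coarse image, but \<open>e\<close> has two
      elements.\<close>
    moreover have "i \<noteq> j"
      using assms(2) e by (auto simp: vertex_pairs_def)
    ultimately show "{i, j} \<in> S"
      using e by (simp add: S_def vertex_pairs_def)
  qed (simp add: S_def)
  have "(\<Sum>s\<in>S. pair_kernel (k * p) s z) = (\<Sum>s\<in>S. if {i, j} = s then 1 else 0)"
    by (simp add: z pair_kernel_def i_def j_def of_bool_def)
  also have "\<dots> = (if {i, j} \<in> S then 1 else 0)"
    using fin by (rule sum.delta')
  also have "\<dots> = pair_kernel p e z"
    unfolding mem by (simp add: z pair_kernel_def i_def j_def coarse_index_block_index[OF assms(1)])
  finally show "pair_kernel p e z = (\<Sum>s\<in>S. pair_kernel (k * p) s z)" by simp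
qed

text \<open>The junk value \<open>block_index m 0 = 0\<close> is harmless: a permutation of \<open>{1..m}\<close> fixes \<open>0\<close>, so the
  point \<open>0\<close>, which lies in no block, stays in place.\<close>

definition block_permutation :: "nat \<Rightarrow> (nat \<Rightarrow> nat) \<Rightarrow> real \<Rightarrow> real" where
  "block_permutation m \<phi> x = x + (real (\<phi> (block_index m x)) - real (block_index m x)) / real m"

text \<open>After scaling by \<open>m\<close> the map adds an integer, and the ceiling commutes with
  that.\<close>

lemma block_index_block_permutation:
  assumes "m > 0" "\<phi> permutes {1..m}" "0 \<le> x"
  shows "block_index m (block_permutation m \<phi> x) = \<phi> (block_index m x)"
proof -
  define i where "i = block_index m x"
  \<comment> \<open>For \<open>0 \<le> x\<close> the ceiling is nonnegative, so \<open>nat\<close>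
    loses nothing.\<close>
  have i: "\<lceil>real m * x\<rceil> = int i"
    using assms(1,3) ceiling_mono[of 0 "real m * x"] by (simp add: i_def block_index_def)
  have "real m * block_permutation m \<phi> x = real m * x + of_int (int (\<phi> i) - int i)"
    using assms(1) by (simp add: block_permutation_def i_def distrib_left)
  then have "\<lceil>real m * block_permutation m \<phi> x\<rceil> = int (\<phi> i)"
    using i by (simp only: ceiling_add_of_int)
  then show ?thesis by (simp add: block_index_def i_def)
qed

lemma unit_interval_iff:
  assumes "m > 0"
  shows "x \<in> {0..1} \<longleftrightarrow> x = 0 \<or> block_index m x \<in> {1..m}"
  using block_index_range[OF assms, of x] by auto

lemma block_permutation_unit_interval:
  assumes "m > 0" "\<phi> permutes {1..m}" "x \<in> {0..1}"
  shows "block_permutation m \<phi> x \<in> {0..1}"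
proof (cases "x = 0")
  case True
  moreover have "\<phi> 0 = 0" using assms(2) by (rule permutes_not_in) simp
  ultimately show ?thesis by (simp add: block_permutation_def block_index_def)
next
  case False
  then have "block_index m x \<in> {1..m}" using assms unit_interval_iff by blast
  then have "\<phi> (block_index m x) \<in> {1..m}" using assms(2) permutes_in_image by metis
  then show ?thesis
    using assms by (metis unit_interval_iff block_index_block_permutation atLeastAtMost_iff)
qed

text \<open>The second displacement is taken at the permuted index and cancels the first. With a
  general left inverse the fact applies to \<phi> and \<open>inv \<phi>\<close> in either
  order.\<close>

lemma block_permutation_inv:
  assumes "m > 0" "\<phi> permutes {1..m}" "\<phi>' \<circ> \<phi> = id" "0 \<le> x"
  shows "block_permutation m \<phi>' (block_permutation m \<phi> x) = x"
proof -
  have "\<phi>' (\<phi> i) = i" for i using assms(3) by (metis comp_apply id_apply)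
  then show ?thesis
    unfolding block_permutation_def[of m \<phi>' "block_permutation m \<phi> x"]
    using block_index_block_permutation[OF assms(1,2,4)]
    by (simp add: block_permutation_def[of m \<phi>] flip: add_divide_distrib)
qed

lemma bij_betw_block_permutation:
  assumes "m > 0" "\<phi> permutes {1..m}"
  shows "bij_betw (block_permutation m \<phi>) {0..1} {0..1}"
proof (rule bij_betw_byWitness[where f' = "block_permutation m (inv \<phi>)"])
  note inv = permutes_inv[OF assms(2)] permutes_inv_o[OF assms(2)]
  show "\<forall>x\<in>{0..1}. block_permutation m (inv \<phi>) (block_permutation m \<phi> x) = x"
    "\<forall>x\<in>{0..1}. block_permutation m \<phi> (block_permutation m (inv \<phi>) x) = x"
    using assms inv by (auto intro: block_permutation_inv)
qed (use assms permutes_inv block_permutation_unit_interval in blast)+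

text \<open>The blocks are disjoint and miss only the point 0 of the unit interval, which is a null
  set.\<close>

lemma emeasure_eq_sum_blocks:
  assumes "m > 0" "B \<subseteq> {0..1}" "\<And>a. a \<in> {1..m} \<Longrightarrow> B \<inter> block m a \<in> sets lebesgue"
  shows "B \<in> sets lebesgue" "emeasure lebesgue B = (\<Sum>a\<in>{1..m}. emeasure lebesgue (B \<inter> block m a))"
proof -
  define U where "U = (\<Union>a\<in>{1..m}. B \<inter> block m a)"
  have U: "U \<in> sets lebesgue" unfolding U_def using assms(3) by (intro sets.finite_UN) auto
  have "x \<in> U \<or> x = 0" if "x \<in> B" for x
    using that assms(1,2) mem_block_iff[OF assms(1)] unit_interval_iff[OF assms(1), of x]
    by (auto simp: U_def)
  then have B: "B = U \<union> (B \<inter> {0})" by (auto simp: U_def)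
  have "negligible (B \<inter> {0})" by (rule negligible_subset[of "{0}"]) auto
  then have null: "B \<inter> {0} \<in> null_sets lebesgue" by (simp add: negligible_iff_null_sets)
  show "B \<in> sets lebesgue"
    by (subst B) (use U null in auto)
  have "emeasure lebesgue B = emeasure lebesgue U"
    by (subst B) (use U null emeasure_Un_null_set in blast)
  also have "\<dots> = (\<Sum>a\<in>{1..m}. emeasure lebesgue (B \<inter> block m a))"
    unfolding U_def using assms(3) mem_block_iff[OF assms(1)]
    by (intro sum_emeasure[symmetric]) (auto simp: disjoint_family_on_def)
  finally show "emeasure lebesgue B = (\<Sum>a\<in>{1..m}. emeasure lebesgue (B \<inter> block m a))" .
qed

text \<open>The map is a translation on each block. A preimage therefore splits into translates of
  the pieces of \<open>A\<close>, and their measures are summed in the order given by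
  \<phi>.\<close>

lemma block_permutation_measure_preserving:
  assumes m: "m > 0" and \<phi>: "\<phi> permutes {1..m}"
  shows "block_permutation m \<phi> \<in> measure_preserving_bijections"
proof -
  define \<sigma> where "\<sigma> = block_permutation m \<phi>"
  let ?M = "lebesgue_on {0..1::real}"
  have sets_M: "A \<in> sets ?M \<longleftrightarrow> A \<in> sets lebesgue \<and> A \<subseteq> {0..1}" for A
    by (subst sets_restrict_space_iff) auto
  have block: "block m a \<in> sets lebesgue" for a by (simp add: block_def)
  have pre: "\<sigma> -` A \<inter> {0..1} \<in> sets lebesgue
      \<and> emeasure lebesgue (\<sigma> -` A \<inter> {0..1}) = emeasure lebesgue A"
    if A: "A \<in> sets lebesgue" "A \<subseteq> {0..1}" for A
  proof -
    \<comment> \<open>The displacement on block \<open>a\<close> with reversed sign: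
      \<open>\<sigma> x = x - d a\<close> there, so preimages are translates by
      \<open>d a\<close>.\<close>
    define d where "d a = (real a - real (\<phi> a)) / real m" for a
    have shift: "(\<sigma> -` A \<inter> {0..1}) \<inter> block m a = (+) (d a) ` (A \<inter> block m (\<phi> a))"
      if a: "a \<in> {1..m}" for a
    proof -
      have \<phi>a: "\<phi> a \<in> {1..m}" using a permutes_in_image[OF \<phi>] by metis
      have "x \<in> (\<sigma> -` A \<inter> {0..1}) \<inter> block m a \<longleftrightarrow> x - d a \<in> A \<inter> block m (\<phi> a)" for x
      proof
        assume x: "x \<in> (\<sigma> -` A \<inter> {0..1}) \<inter> block m a"
        then have i: "block_index m x = a" using mem_block_iff[OF m] a by auto
        then have "\<sigma> x = x - d a"
          by (simp add: \<sigma>_def block_permutation_def d_def diff_divide_distrib)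
        moreover have "block_index m (\<sigma> x) = \<phi> a"
          using x i block_index_block_permutation[OF m \<phi>] by (simp add: \<sigma>_def)
        ultimately show "x - d a \<in> A \<inter> block m (\<phi> a)"
          using x \<phi>a mem_block_iff[OF m, of "\<phi> a"] by auto
      next
        assume x: "x - d a \<in> A \<inter> block m (\<phi> a)"
        then have "x \<in> block m a"
          using m by (auto simp: block_def d_def diff_divide_distrib)
        moreover from this have i: "block_index m x = a" using mem_block_iff[OF m] a by auto
        then have "\<sigma> x = x - d a"
          by (simp add: \<sigma>_def block_permutation_def d_def diff_divide_distrib)
        moreover have "x \<in> {0..1}"
          using i a unit_interval_iff[OF m] by blast
        ultimately show "x \<in> (\<sigma> -` A \<inter> {0..1}) \<inter> block m a"
          using x by auto
      qed
      \<comment> \<open>This puts the translate into the pointwise form of the equivalence just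
        shown.\<close>
      moreover have "(+) c ` T = {x. x - c \<in> T}" for c and T :: "real set"
        by force
      ultimately show ?thesis
        by (intro set_eqI) (simp only: mem_Collect_eq)
    qed
    have meas: "(\<sigma> -` A \<inter> {0..1}) \<inter> block m a \<in> sets lebesgue" if "a \<in> {1..m}" for a
      unfolding shift[OF that] using A block by (intro lebesgue_sets_translation) auto
    have tr: "emeasure lebesgue ((+) c ` S) = emeasure lebesgue S" for c and S :: "real set"
      using emeasure_lebesgue_affine[of 1 c S] by (simp add: add.commute cong: image_cong_simp)
    have "emeasure lebesgue (\<sigma> -` A \<inter> {0..1})
        = (\<Sum>a\<in>{1..m}. emeasure lebesgue ((\<sigma> -` A \<inter> {0..1}) \<inter> block m a))"
      by (rule emeasure_eq_sum_blocks(2)[OF m _ meas]) auto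
    also have "\<dots> = (\<Sum>a\<in>{1..m}. emeasure lebesgue (A \<inter> block m (\<phi> a)))"
      by (intro sum.cong) (simp_all only: shift tr)
    also have "\<dots> = (\<Sum>a\<in>{1..m}. emeasure lebesgue (A \<inter> block m a))"
      by (rule sum.permute[OF \<phi>, symmetric, unfolded comp_def])
    also have "\<dots> = emeasure lebesgue A"
      by (rule emeasure_eq_sum_blocks(2)[OF m A(2), symmetric]) (use A block in auto)
    finally show ?thesis
      using emeasure_eq_sum_blocks(1)[OF m _ meas] by auto
  qed
  have meas: "\<sigma> \<in> measurable ?M ?M"
  proof (rule measurableI)
    show "\<sigma> x \<in> space ?M" if "x \<in> space ?M" for x
      using that block_permutation_unit_interval[OF m \<phi>] by (simp add: \<sigma>_def)
    show "\<sigma> -` A \<inter> space ?M \<in> sets ?M" if "A \<in> sets ?M" for A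
      using that pre[of A] by (auto simp: sets_M)
  qed
  have "distr ?M ?M \<sigma> = ?M"
  proof (rule measure_eqI)
    fix A assume "A \<in> sets (distr ?M ?M \<sigma>)"
    then have A: "A \<in> sets ?M" "A \<in> sets lebesgue" "A \<subseteq> {0..1}" by (auto simp: sets_M)
    have "emeasure (distr ?M ?M \<sigma>) A = emeasure ?M (\<sigma> -` A \<inter> {0..1})"
      using emeasure_distr[OF meas A(1)] by simp
    also have "\<dots> = emeasure lebesgue (\<sigma> -` A \<inter> {0..1})"
      by (rule emeasure_restrict_space) auto
    also have "\<dots> = emeasure lebesgue A" using pre A by blast
    also have "\<dots> = emeasure ?M A"
      by (rule emeasure_restrict_space[symmetric]) (use A in auto)
    finally show "emeasure (distr ?M ?M \<sigma>) A = emeasure ?M A" .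
  qed simp
  then show ?thesis
    using meas bij_betw_block_permutation[OF m \<phi>]
    by (simp add: measure_preserving_bijections_def \<sigma>_def)
qed

text \<open>Injectivity cancels \<phi> from both index pairs; a relabelling of vertices thus becomes
  a change of variable.\<close>

lemma pullback_block_permutation:
  assumes "m > 0" "\<phi> permutes {1..m}" "s \<in> vertex_pairs m"
  shows "pullback (block_permutation m \<phi>) (pair_kernel m (\<phi> ` s)) = pair_kernel m s"
proof
  fix z :: "real \<times> real"
  obtain x y where z: "z = (x, y)" by fastforce
  show "pullback (block_permutation m \<phi>) (pair_kernel m (\<phi> ` s)) z = pair_kernel m s z"
  proof (cases "z \<in> unit_square")
    case True
    have "{\<phi> i, \<phi> j} = \<phi> ` s \<longleftrightarrow> {i, j} = s" for i j
      using inj_image_eq_iff[OF permutes_inj[OF assms(2)], of "{i, j}" s] by simp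
    then show ?thesis
      using True assms
      by (simp add: z pullback_def pair_kernel_def block_index_block_permutation)
  next
    case False
    then show ?thesis
      using pair_kernel_outside[OF assms(3) False] unfolding pullback_def z
      by (simp only: case_prod_conv if_False)
  qed
qed

section \<open>Expansion of functionals\<close>

definition block_tuple :: "nat \<Rightarrow> nat \<Rightarrow> (nat \<Rightarrow> nat set) \<Rightarrow> nat \<Rightarrow> real \<times> real \<Rightarrow> real" where
  "block_tuple n m L = (\<lambda>l\<in>{1..n}. pair_kernel m (L l))"

lemma block_tuple_in_kernel_tuples:
  "L \<in> {1..n} \<rightarrow> vertex_pairs m \<Longrightarrow> block_tuple n m L \<in> kernel_tuples n"
  by (auto simp: block_tuple_def kernel_tuples_def intro: pair_kernel_in_kernels)

text \<open>Injectivity of \<open>pair_kernel\<close> makes the definite description return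
  \<open>L l\<close>. This is shown for \<open>l\<close> in \<open>{1..n}\<close> only, hence a
  comparison of classes instead of records.\<close>

lemma tuple_graph_block_tuple:
  assumes L: "L \<in> {1..n} \<rightarrow> vertex_pairs m"
  shows "multigraph (tuple_graph n m (block_tuple n m L))"
    and "iso_class (tuple_graph n m (block_tuple n m L)) = iso_class (labelled_graph n m L)"
proof -
  have ends: "ends (tuple_graph n m (block_tuple n m L)) l = L l" if l: "l \<in> {1..n}" for l
  proof -
    have *: "(\<exists>a b. 1 \<le> a \<and> a < b \<and> b \<le> m \<and> s = {a, b}
        \<and> block_tuple n m L l = block_kernel m a b) \<longleftrightarrow> s = L l" for s
    proof -
      have eq: "block_kernel m a b = pair_kernel m {a, b}" if "1 \<le> a" "a < b" "b \<le> m" for a b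
        using that by (intro block_kernel_eq_pair_kernel) auto
      have "(\<exists>a b. 1 \<le> a \<and> a < b \<and> b \<le> m \<and> s = {a, b}
          \<and> block_tuple n m L l = block_kernel m a b)
        \<longleftrightarrow> s \<in> vertex_pairs m \<and> block_tuple n m L l = pair_kernel m s"
        unfolding vertex_pairs_iff using eq by metis
      also have "\<dots> \<longleftrightarrow> s = L l"
        using l L inj_on_eq_iff[OF inj_on_pair_kernel] by (auto simp: block_tuple_def Pi_iff)
      finally show ?thesis .
    qed
    show ?thesis
      by (simp only: tuple_graph_def multigraph.simps * the_eq_trivial)
  qed
  have G: "multigraph (labelled_graph n m L)" using L by (rule multigraph_labelled_graph)
  have simps: "verts (tuple_graph n m (block_tuple n m L)) = {1..m}"
    "edges (tuple_graph n m (block_tuple n m L)) = {1..n}"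
    by (simp_all add: tuple_graph_def)
  show "multigraph (tuple_graph n m (block_tuple n m L))"
    using G ends by (simp add: multigraph_def simps) (simp add: labelled_graph_def)
  moreover have "multigraph_iso (tuple_graph n m (block_tuple n m L)) (labelled_graph n m L)"
    by (rule multigraph_isoI[of id _ _ id]) (simp_all add: simps ends labelled_graph_def)
  ultimately show "iso_class (tuple_graph n m (block_tuple n m L)) = iso_class (labelled_graph n m L)"
    using G iso_class_eq_iff by blast
qed

text \<open>Symmetry of the functional absorbs the edge bijection, and its invariance under
  permutations of blocks absorbs the vertex bijection.\<close>

lemma functional_block_tuple_cong:
  assumes \<Lambda>: "\<Lambda> \<in> functionals n" and m: "m > 0"
    and L: "L \<in> {1..n} \<rightarrow> vertex_pairs m" and L': "L' \<in> {1..n} \<rightarrow> vertex_pairs m"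
    and iso: "multigraph_iso (labelled_graph n m L) (labelled_graph n m L')"
  shows "\<Lambda> (block_tuple n m L) = \<Lambda> (block_tuple n m L')"
proof -
  obtain \<phi> \<psi> where *: "bij_betw \<phi> {1..m} {1..m}" "bij_betw \<psi> {1..n} {1..n}"
    "\<And>l. l \<in> {1..n} \<Longrightarrow> L' (\<psi> l) = \<phi> ` L l"
    using multigraph_isoE[OF iso] by (auto simp: labelled_graph_def)
  \<comment> \<open>\<open>permutes\<close> demands the identity outside the set, where the
    isomorphism says nothing.\<close>
  define \<phi>' where "\<phi>' v = (if v \<in> {1..m} then \<phi> v else v)" for v
  define \<psi>' where "\<psi>' l = (if l \<in> {1..n} then \<psi> l else l)" for l
  have "bij_betw \<phi>' {1..m} {1..m}" "bij_betw \<psi>' {1..n} {1..n}"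
    using *(1,2) bij_betw_cong[of "{1..m}" \<phi>' \<phi> "{1..m}"] bij_betw_cong[of "{1..n}" \<psi>' \<psi> "{1..n}"]
    by (simp_all add: \<phi>'_def \<psi>'_def)
  then have \<phi>': "\<phi>' permutes {1..m}" and \<psi>': "\<psi>' permutes {1..n}"
    by (auto intro!: bij_imp_permutes simp: \<phi>'_def \<psi>'_def)
  have img: "L' (\<psi>' l) = \<phi>' ` L l" if "l \<in> {1..n}" for l
  proof -
    have "L l \<subseteq> {1..m}" using L that by (auto simp: Pi_iff vertex_pairs_def)
    then have "\<phi>' ` L l = \<phi> ` L l" by (intro image_cong) (auto simp: \<phi>'_def)
    then show ?thesis using *(3)[OF that] that by (simp add: \<psi>'_def)
  qed
  \<comment> \<open>The tuple between the two: its pullback is the tuple of \<open>L\<close>, and it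
    is itself the tuple of \<open>L'\<close> with permuted arguments.\<close>
  define y where "y = (\<lambda>l\<in>{1..n}. pair_kernel m (\<phi>' ` L l))"
  have \<psi>'in: "\<psi>' l \<in> {1..n}" if "l \<in> {1..n}" for l
    using that permutes_in_image[OF \<psi>'] by metis
  have y: "y = (\<lambda>l\<in>{1..n}. block_tuple n m L' (\<psi>' l))"
    unfolding y_def block_tuple_def using \<psi>'in img by (intro restrict_ext) (simp del: atLeastAtMost_iff)
  have "y \<in> kernel_tuples n"
    using L' \<psi>'in img unfolding y_def kernel_tuples_def
    by (auto simp del: atLeastAtMost_iff intro!: pair_kernel_in_kernels simp: Pi_iff simp flip: img)
  then have "\<Lambda> (\<lambda>l\<in>{1..n}. pullback (block_permutation m \<phi>') (y l)) = \<Lambda> y"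
    using \<Lambda> block_permutation_measure_preserving[OF m \<phi>'] by (simp add: functionals_def)
  moreover have "(\<lambda>l\<in>{1..n}. pullback (block_permutation m \<phi>') (y l)) = block_tuple n m L"
    unfolding block_tuple_def using L pullback_block_permutation[OF m \<phi>']
    by (intro restrict_ext) (auto simp: y_def Pi_iff)
  moreover have "\<Lambda> y = \<Lambda> (block_tuple n m L')"
    unfolding y using \<Lambda> \<psi>' block_tuple_in_kernel_tuples[OF L'] by (simp add: functionals_def)
  ultimately show ?thesis by simp
qed

text \<open>Whatever tuple \<open>SOME\<close> picks is again a \<open>block_tuple\<close>, with a
  graph isomorphic to that of \<open>L\<close>, so the value does not depend on the choice.\<close>

lemma coordinate_labelled_graph:
  assumes \<Lambda>: "\<Lambda> \<in> functionals n" and m: "m > 0" and L: "L \<in> {1..n} \<rightarrow>\<^sub>E vertex_pairs m"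
  shows "coordinate n m \<Lambda> (iso_class (labelled_graph n m L)) = \<Lambda> (block_tuple n m L)"
  unfolding coordinate_def
proof (rule someI2[where Q = "\<lambda>x. \<Lambda> x = \<Lambda> (block_tuple n m L)"])
  have L': "L \<in> {1..n} \<rightarrow> vertex_pairs m" using L by auto
  then show "block_tuple n m L \<in> {1..n} \<rightarrow>\<^sub>E block_kernels m
      \<and> iso_class (tuple_graph n m (block_tuple n m L)) = iso_class (labelled_graph n m L)"
    using tuple_graph_block_tuple[OF L'] by (auto simp: block_tuple_def block_kernels_eq)
  fix x assume x: "x \<in> {1..n} \<rightarrow>\<^sub>E block_kernels m
      \<and> iso_class (tuple_graph n m x) = iso_class (labelled_graph n m L)"
  then have "\<forall>l\<in>{1..n}. \<exists>s\<in>vertex_pairs m. x l = pair_kernel m s"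
    by (auto simp: block_kernels_eq)
  then obtain K where K: "\<forall>l\<in>{1..n}. K l \<in> vertex_pairs m \<and> x l = pair_kernel m (K l)"
    by metis
  then have K': "K \<in> {1..n} \<rightarrow> vertex_pairs m" by auto
  have xK: "x = block_tuple n m K"
    using x K by (auto simp: block_tuple_def PiE_iff extensional_def fun_eq_iff)
  have "multigraph_iso (labelled_graph n m K) (labelled_graph n m L)"
    using x tuple_graph_block_tuple(2)[OF K'] multigraph_labelled_graph[OF K']
      multigraph_labelled_graph[OF L'] iso_class_eq_iff unfolding xK by metis
  then show "\<Lambda> x = \<Lambda> (block_tuple n m L)"
    unfolding xK by (rule functional_block_tuple_cong[OF \<Lambda> m K' L'])
qed

section \<open>Spans of kernels and multilinear expansion\<close>

lemma kernels_subset_kernel_span: "kernels \<subseteq> kernel_span"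
proof
  fix f assume "f \<in> kernels"
  then show "f \<in> kernel_span"
    unfolding kernel_span_def mem_Collect_eq
    by (intro exI[of _ "{f}"] exI[of _ "\<lambda>_. 1"]) auto
qed

lemma zero_in_kernel_span: "(\<lambda>z. 0) \<in> kernel_span"
  unfolding kernel_span_def mem_Collect_eq by (intro exI[of _ "{}"]) auto

lemma kernel_span_add:
  assumes "f \<in> kernel_span" "g \<in> kernel_span"
  shows "(\<lambda>z. f z + g z) \<in> kernel_span"
proof -
  obtain S c where S: "finite S" "S \<subseteq> kernels" "f = (\<lambda>z. \<Sum>w\<in>S. c w * w z)"
    using assms(1) by (auto simp: kernel_span_def)
  obtain T d where T: "finite T" "T \<subseteq> kernels" "g = (\<lambda>z. \<Sum>w\<in>T. d w * w z)"
    using assms(2) by (auto simp: kernel_span_def)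
  \<comment> \<open>\<open>of_bool\<close> masks each coefficient function outside its own set,
    where its values are arbitrary.\<close>
  have "f z + g z = (\<Sum>w\<in>S \<union> T. (of_bool (w \<in> S) * c w + of_bool (w \<in> T) * d w) * w z)" for z
  proof -
    have "(\<Sum>w\<in>S. c w * w z) = (\<Sum>w\<in>S \<union> T. of_bool (w \<in> S) * c w * w z)"
      using S T by (intro sum.mono_neutral_cong_left) auto
    moreover have "(\<Sum>w\<in>T. d w * w z) = (\<Sum>w\<in>S \<union> T. of_bool (w \<in> T) * d w * w z)"
      using S T by (intro sum.mono_neutral_cong_left) auto
    ultimately show ?thesis
      unfolding S(3) T(3) by (simp only: distrib_right sum.distrib)
  qed
  then show ?thesis
    unfolding kernel_span_def mem_Collect_eq
    by (intro exI[of _ "S \<union> T"] exI[of _ "\<lambda>w. of_bool (w \<in> S) * c w + of_bool (w \<in> T) * d w"])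
      (use S T in auto)
qed

lemma kernel_span_sum:
  assumes "finite S" "\<And>s. s \<in> S \<Longrightarrow> f s \<in> kernel_span"
  shows "(\<lambda>z. \<Sum>s\<in>S. f s z) \<in> kernel_span"
  using assms by (induction S) (auto intro: zero_in_kernel_span kernel_span_add)

lemma multilinear_sum:
  assumes M: "multilinear_on_span n M" and g: "g \<in> kernel_span_tuples n" and i: "i \<in> {1..n}"
    and "finite S" "\<And>s. s \<in> S \<Longrightarrow> f s \<in> kernel_span"
  shows "M (g(i := (\<lambda>z. \<Sum>s\<in>S. f s z))) = (\<Sum>s\<in>S. M (g(i := f s)))"
proof -
  have lin: "M (g(i := (\<lambda>z. a * u z + b * v z))) = a * M (g(i := u)) + b * M (g(i := v))"
    if "u \<in> kernel_span" "v \<in> kernel_span" for a b u v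
    using M g i that unfolding multilinear_on_span_def by blast
  show ?thesis
    using assms(4,5)
  proof (induction S)
    case empty
    \<comment> \<open>Linearity with both coefficients 0 makes the empty sum vanish.\<close>
    show ?case using lin[OF zero_in_kernel_span zero_in_kernel_span, of 0 0] by (simp del: fun_upd_apply)
  next
    case (insert s S)
    then show ?case
      using lin[of "f s" "\<lambda>z. \<Sum>s\<in>S. f s z" 1 1] kernel_span_sum[of S f] by (simp del: fun_upd_apply)
  qed
qed

text \<open>Induction on the set \<open>J\<close> of arguments already expanded. The others still
  hold \<open>g\<close>, so each step is linearity in a single argument.\<close>

lemma multilinear_expand:
  assumes M: "multilinear_on_span n M" and g: "g \<in> kernel_span_tuples n"
    and T: "\<And>l. finite (T l)" and f: "\<And>l s. l \<in> {1..n} \<Longrightarrow> s \<in> T l \<Longrightarrow> f s \<in> kernel_span"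
    and J: "finite J" "J \<subseteq> {1..n}"
    and eq: "\<And>l. l \<in> {1..n} \<Longrightarrow> g l = (\<lambda>z. \<Sum>s\<in>T l. f s z)"
  shows "M g = (\<Sum>L\<in>Pi\<^sub>E J T. M (\<lambda>l. if l \<in> J then f (L l) else g l))"
  using J
proof (induction J)
  case empty
  show ?case by simp
next
  case (insert i J)
  then have i: "i \<in> {1..n}" by auto
  define h where "h L = (\<lambda>l. if l \<in> J then f (L l) else g l)" for L
  have h: "M (h L) = (\<Sum>s\<in>T i. M ((h L)(i := f s)))" if L: "L \<in> Pi\<^sub>E J T" for L
  proof -
    have "h L \<in> kernel_span_tuples n"
      using g f L insert.prems unfolding h_def kernel_span_tuples_def PiE_iff extensional_def
      by (auto simp: subset_iff)
    then have "M ((h L)(i := (\<lambda>z. \<Sum>s\<in>T i. f s z))) = (\<Sum>s\<in>T i. M ((h L)(i := f s)))"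
      by (rule multilinear_sum[OF M _ i T f[OF i]])
    \<comment> \<open>Argument \<open>i\<close> of \<open>h L\<close> is still \<open>g i\<close>,
      which is this very sum.\<close>
    moreover have "(h L)(i := (\<lambda>z. \<Sum>s\<in>T i. f s z)) = h L"
      using insert.hyps eq[OF i] by (simp add: h_def fun_upd_idem_iff)
    ultimately show ?thesis by simp
  qed
  have "M g = (\<Sum>L\<in>Pi\<^sub>E J T. M (h L))"
    using insert by (simp add: h_def)
  also have "\<dots> = (\<Sum>L\<in>Pi\<^sub>E J T. \<Sum>s\<in>T i. M ((h L)(i := f s)))"
    using h by (rule sum.cong[OF refl])
  also have "\<dots> = (\<Sum>s\<in>T i. \<Sum>L\<in>Pi\<^sub>E J T. M ((h L)(i := f s)))"
    by (rule sum.swap)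
  also have "\<dots> = (\<Sum>(s, L)\<in>T i \<times> Pi\<^sub>E J T. M ((h L)(i := f s)))"
    by (rule sum.cartesian_product)
  also have "\<dots> = (\<Sum>(s, L)\<in>T i \<times> Pi\<^sub>E J T.
      M (\<lambda>l. if l \<in> insert i J then f ((L(i := s)) l) else g l))"
  proof -
    have "(h L)(i := f s) = (\<lambda>l. if l \<in> insert i J then f ((L(i := s)) l) else g l)" for L s
      using insert.hyps by (auto simp: h_def fun_eq_iff)
    then show ?thesis by (simp only:)
  qed
  \<comment> \<open>A choice on \<open>insert i J\<close> is a value at \<open>i\<close> together
    with a choice on \<open>J\<close>.\<close>
  also have "\<dots> = (\<Sum>L\<in>Pi\<^sub>E (insert i J) T. M (\<lambda>l. if l \<in> insert i J then f (L l) else g l))"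
    unfolding PiE_insert_eq sum.reindex[OF inj_combinator[OF insert.hyps(2)]]
    by (intro sum.cong) auto
  finally show ?case .
qed

lemma block_tuple_refine:
  assumes \<Lambda>: "\<Lambda> \<in> functionals n" and k: "k \<ge> 1" and L: "L \<in> {1..n} \<rightarrow>\<^sub>E vertex_pairs p"
  shows "\<Lambda> (block_tuple n p L)
       = (\<Sum>K\<in>edge_lifts (coarse_index k) {1..k * p} (labelled_graph n p L).
            \<Lambda> (block_tuple n (k * p) K))"
proof -
  obtain M where M: "multilinear_on_span n M" "\<And>g. g \<in> kernel_tuples n \<Longrightarrow> M g = \<Lambda> g"
    using \<Lambda> by (auto simp: functionals_def)
  define T where "T l = {s \<in> vertex_pairs (k * p). coarse_index k ` s = L l}" for l
  \<comment> \<open>An edge lift is exactly a choice of one summand in every argument.\<close>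
  have lifts: "edge_lifts (coarse_index k) {1..k * p} (labelled_graph n p L) = Pi\<^sub>E {1..n} T"
    unfolding edge_lifts_def labelled_graph_def T_def vertex_pairs_def
    by (simp del: atLeastAtMost_iff)
  have L': "L \<in> {1..n} \<rightarrow> vertex_pairs p" using L by auto
  have span: "block_tuple n p L \<in> kernel_span_tuples n"
    using block_tuple_in_kernel_tuples[OF L'] kernels_subset_kernel_span
    unfolding kernel_tuples_def kernel_span_tuples_def by (meson PiE_mono subsetD)
  have "\<Lambda> (block_tuple n p L) = M (block_tuple n p L)"
    using M(2) block_tuple_in_kernel_tuples[OF L'] by simp
  also have "\<dots> = (\<Sum>K\<in>Pi\<^sub>E {1..n} T.
      M (\<lambda>l. if l \<in> {1..n} then pair_kernel (k * p) (K l) else block_tuple n p L l))"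
  proof (rule multilinear_expand[OF M(1) span])
    show "finite (T l)" for l using finite_vertex_pairs by (simp add: T_def)
    show "pair_kernel (k * p) s \<in> kernel_span" if "s \<in> T l" for l s
      using that pair_kernel_in_kernels kernels_subset_kernel_span by (auto simp: T_def)
    show "block_tuple n p L l = (\<lambda>z. \<Sum>s\<in>T l. pair_kernel (k * p) s z)" if "l \<in> {1..n}" for l
      using that L' pair_kernel_refine[OF k, of "L l" p] by (auto simp: block_tuple_def T_def Pi_iff)
  qed auto
  also have "\<dots> = (\<Sum>K\<in>Pi\<^sub>E {1..n} T. \<Lambda> (block_tuple n (k * p) K))"
  proof (rule sum.cong[OF refl])
    fix K assume "K \<in> Pi\<^sub>E {1..n} T"
    then have "K \<in> {1..n} \<rightarrow> vertex_pairs (k * p)" by (auto simp: T_def PiE_iff)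
    moreover have "(\<lambda>l. if l \<in> {1..n} then pair_kernel (k * p) (K l) else block_tuple n p L l)
        = block_tuple n (k * p) K"
      by (auto simp: block_tuple_def fun_eq_iff)
    ultimately show "M (\<lambda>l. if l \<in> {1..n} then pair_kernel (k * p) (K l) else block_tuple n p L l)
        = \<Lambda> (block_tuple n (k * p) K)"
      using M(2) block_tuple_in_kernel_tuples by metis
  qed
  finally show ?thesis by (simp only: lifts)
qed

section \<open>Counting lifts\<close>

text \<open>The sub-blocks of a vertex are pairs \<open>(v, i)\<close> and not numbers, because the
  vertices of \<open>G\<close> may be any naturals and no number of blocks may enter.\<close>

definition lift_count :: "nat \<Rightarrow> graph \<Rightarrow> graph \<Rightarrow> nat" where
  "lift_count k G H = card {L \<in> edge_lifts fst (verts G \<times> {..<k}) G.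
     multigraph_iso (spanned_graph (edges G) L) H}"

text \<open>The isomorphism followed by \<open>fst\<close> is the vertex map. It reaches every
  vertex because each lies on an edge; the edge map is even bijective.\<close>

lemma lift_count_surjects_onto:
  assumes G: "multigraph G" "isolated_verts G = {}" and "lift_count k G H \<noteq> 0"
  shows "surjects_onto H G"
proof -
  obtain L where L: "L \<in> edge_lifts fst (verts G \<times> {..<k}) G"
    and iso: "multigraph_iso (spanned_graph (edges G) L) H"
    using assms(3) unfolding lift_count_def by (metis (mono_tags, lifting) card.empty empty_Collect_eq)
  note D = edge_liftsD[OF L]
  have "multigraph (spanned_graph (edges G) L)"
    using G(1) D(2) by (intro multigraph_spanned_graph) (auto simp: multigraph_def)
  then obtain \<phi> \<psi> where *: "bij_betw \<phi> (verts H) (\<Union> (L ` edges G))"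
    "bij_betw \<psi> (edges H) (edges G)" "\<And>e. e \<in> edges H \<Longrightarrow> L (\<psi> e) = \<phi> ` ends H e"
    using multigraph_isoE[OF multigraph_iso_sym[OF _ iso]] by (auto simp: spanned_graph_def)
  have "fst ` \<Union> (L ` edges G) = \<Union> (ends G ` edges G)"
    using D(3) by (simp add: image_UN)
  also have "\<dots> = verts G"
    using verts_remove_isolated[OF G(1)] G(2) by (simp add: remove_isolated_def)
  finally have verts: "(fst \<circ> \<phi>) ` verts H = verts G"
    using *(1) by (simp add: bij_betw_def flip: image_image image_comp)
  moreover have edges: "\<psi> ` edges H = edges G"
    using *(2) by (simp add: bij_betw_def)
  moreover have "multigraph_map H G (fst \<circ> \<phi>) \<psi>"
    unfolding multigraph_map_def
  proof (intro conjI ballI)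
    fix e assume e: "e \<in> edges H"
    then have "\<psi> e \<in> edges G" using edges by auto
    then show "ends G (\<psi> e) = (fst \<circ> \<phi>) ` ends H e"
      using D(3)[of "\<psi> e"] *(3)[OF e] by (simp add: image_comp)
  qed (use verts edges in auto)
  ultimately show ?thesis unfolding surjects_onto_def by blast
qed

lemma lift_count_self_pos:
  assumes G: "multigraph G" "isolated_verts G = {}" and k: "k \<ge> 1" and iso: "multigraph_iso G H"
  shows "lift_count k G H > 0"
proof -
  define L where "L = (\<lambda>e\<in>edges G. (\<lambda>v. (v, 0::nat)) ` ends G e)"
  have inj: "inj_on (\<lambda>v. (v, 0::nat)) A" for A :: "nat set" by (simp add: inj_on_def)
  have "L \<in> edge_lifts fst (verts G \<times> {..<k}) G"
    unfolding edge_lifts_def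
  proof
    fix e assume e: "e \<in> edges G"
    then have "ends G e \<subseteq> verts G" "card (ends G e) = 2"
      using G(1) by (auto simp: multigraph_def)
    then show "L e \<in> {s. s \<subseteq> verts G \<times> {..<k} \<and> card s = 2 \<and> fst ` s = ends G e}"
      using k e card_image[OF inj, of "ends G e"] by (auto simp: L_def image_image)
  qed (simp add: L_def)
  moreover have "multigraph_iso (spanned_graph (edges G) L) G"
  proof (rule multigraph_iso_sym)
    show "multigraph_iso G (spanned_graph (edges G) L)"
    proof (rule multigraph_isoI)
      have "verts G = \<Union> (ends G ` edges G)"
        using verts_remove_isolated[OF G(1)] G(2) by (simp add: remove_isolated_def)
      then have "verts (spanned_graph (edges G) L) = (\<lambda>v. (v, 0)) ` verts G"
        by (simp add: spanned_graph_def L_def image_UN)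
      then show "bij_betw (\<lambda>v. (v, 0)) (verts G) (verts (spanned_graph (edges G) L))"
        using inj by (simp add: bij_betw_def)
      show "bij_betw id (edges G) (edges (spanned_graph (edges G) L))"
        by (simp add: spanned_graph_def)
    qed (simp add: spanned_graph_def L_def)
  qed (rule G)
  ultimately have "L \<in> {L \<in> edge_lifts fst (verts G \<times> {..<k}) G.
      multigraph_iso (spanned_graph (edges G) L) H}"
    using iso multigraph_iso_trans by blast
  moreover have "finite (edge_lifts fst (verts G \<times> {..<k}) G)"
    using G(1) by (intro finite_edge_lifts) (auto simp: multigraph_def)
  ultimately show ?thesis
    unfolding lift_count_def by (intro card_gt_0_iff[THEN iffD2]) auto
qed

text \<open>Over vertices that meet an edge, fine block numbers correspond to pairs of a vertex and
  an offset, and lifts use no other blocks. Proving two inequalities allows two unrelated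
  isomorphisms, one for each direction.\<close>

lemma card_labelled_lifts:
  assumes k: "k \<ge> 1" and L: "L \<in> {1..n} \<rightarrow> vertex_pairs p"
    and G: "multigraph G" "multigraph_iso (remove_isolated (labelled_graph n p L)) G"
  shows "card {K \<in> edge_lifts (coarse_index k) {1..k * p} (labelled_graph n p L).
      multigraph_iso (spanned_graph {1..n} K) H} = lift_count k G H"
proof -
  let ?A = "labelled_graph n p L"
  define U where "U = \<Union> (L ` {1..n})"
  have U: "U \<subseteq> {1..p}" using L by (auto simp: U_def Pi_iff vertex_pairs_def)
  have rm: "remove_isolated ?A = spanned_graph {1..n} L"
    by (rule remove_isolated_labelled_graph[OF L])
  obtain \<phi> \<psi> where *: "bij_betw \<phi> U (verts G)" "bij_betw \<psi> {1..n} (edges G)"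
    "\<And>l. l \<in> {1..n} \<Longrightarrow> ends G (\<psi> l) = \<phi> ` L l"
    using multigraph_isoE[OF G(2)] unfolding rm U_def by (auto simp: spanned_graph_def)
  have "multigraph (remove_isolated ?A)"
    using L by (intro multigraph_remove_isolated multigraph_labelled_graph)
  from multigraph_isoE[OF multigraph_iso_sym[OF this G(2)]]
  obtain \<phi>' \<psi>' where **: "bij_betw \<phi>' (verts G) U" "bij_betw \<psi>' (edges G) {1..n}"
    "\<And>e. e \<in> edges G \<Longrightarrow> L (\<psi>' e) = \<phi>' ` ends G e"
    unfolding rm U_def by (auto simp: spanned_graph_def)
  have simps [simp]: "edges ?A = {1..n}" "ends ?A = L" by (simp_all add: labelled_graph_def)
  have fin: "finite (verts G)" "finite (edges G)" using G(1) by (auto simp: multigraph_def)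
  have UG: "\<Union> (ends G ` edges G) \<subseteq> verts G" using G(1) by (auto simp: multigraph_def)
  \<comment> \<open>Block numbers start at 1 and offsets at 0, hence the corrections by 1.\<close>
  have split: "\<exists>v i. v \<in> U \<and> v \<ge> 1 \<and> i < k \<and> w = k * (v - 1) + i + 1 \<and> coarse_index k w = v"
    if "coarse_index k w \<in> U" for w
    using that U coarse_index_eq_iff[OF k, of "coarse_index k w" w] by fastforce
  have "card {K \<in> edge_lifts (coarse_index k) {1..k * p} ?A.
      multigraph_iso (spanned_graph (edges ?A) K) H}
    \<le> card {K \<in> edge_lifts fst (verts G \<times> {..<k}) G. multigraph_iso (spanned_graph (edges G) K) H}"
  \<comment> \<open>The second component is the offset of \<open>w\<close> inside its coarse
    block.\<close>
  proof (rule card_edge_lifts_le[where \<psi> = \<psi> and \<phi> = \<phi>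
        and \<Phi> = "\<lambda>w. (\<phi> (coarse_index k w), w - k * (coarse_index k w - 1) - 1)"])
    show "inj_on (\<lambda>w. (\<phi> (coarse_index k w), w - k * (coarse_index k w - 1) - 1))
      {w \<in> {1..k * p}. coarse_index k w \<in> \<Union> (ends ?A ` edges ?A)}"
    proof (rule inj_onI)
      fix w w'
      assume "w \<in> {w \<in> {1..k * p}. coarse_index k w \<in> \<Union> (ends ?A ` edges ?A)}"
        and "w' \<in> {w \<in> {1..k * p}. coarse_index k w \<in> \<Union> (ends ?A ` edges ?A)}"
        and "(\<phi> (coarse_index k w), w - k * (coarse_index k w - 1) - 1)
          = (\<phi> (coarse_index k w'), w' - k * (coarse_index k w' - 1) - 1)"
      then have w: "coarse_index k w \<in> U" and w': "coarse_index k w' \<in> U"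
        and eq: "\<phi> (coarse_index k w) = \<phi> (coarse_index k w')"
          "w - k * (coarse_index k w - 1) - 1 = w' - k * (coarse_index k w' - 1) - 1"
        by (auto simp: U_def)
      have "coarse_index k w = coarse_index k w'"
        using *(1) eq(1) w w' unfolding bij_betw_def inj_on_def by blast
      then show "w = w'"
        using split[of w] split[of w'] w w' eq(2) by auto
    qed
    show "(\<phi> (coarse_index k w), w - k * (coarse_index k w - 1) - 1) \<in> verts G \<times> {..<k}
        \<and> fst (\<phi> (coarse_index k w), w - k * (coarse_index k w - 1) - 1) = \<phi> (coarse_index k w)"
      if "w \<in> {1..k * p}" "coarse_index k w \<in> \<Union> (ends ?A ` edges ?A)" for w
    proof -
      have "coarse_index k w \<in> U" using that by (simp add: U_def)
      moreover from this have "\<phi> (coarse_index k w) \<in> verts G" using *(1) bij_betwE by blast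
      ultimately show ?thesis
        using split[of w] by auto
    qed
  qed (use * fin in auto)
  moreover have "card {K \<in> edge_lifts fst (verts G \<times> {..<k}) G.
      multigraph_iso (spanned_graph (edges G) K) H}
    \<le> card {K \<in> edge_lifts (coarse_index k) {1..k * p} ?A.
      multigraph_iso (spanned_graph (edges ?A) K) H}"
  \<comment> \<open>Exactly \<open>k * (\<phi>' v - 1)\<close> fine blocks precede those of the
    coarse block \<open>\<phi>' v\<close>; the subtraction is safe because
    \<open>\<phi>' v \<ge> 1\<close>.\<close>
  proof (rule card_edge_lifts_le[where \<psi> = \<psi>' and \<phi> = \<phi>'
        and \<Phi> = "\<lambda>(v, i). k * (\<phi>' v - 1) + i + 1"])
    have idx: "coarse_index k (k * (\<phi>' v - 1) + i + 1) = \<phi>' v" "\<phi>' v \<ge> 1" "\<phi>' v \<le> p"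
      if "v \<in> verts G" "i < k" for v i
    proof -
      have "\<phi>' v \<in> U" using **(1) that(1) bij_betwE by blast
      then show *: "\<phi>' v \<ge> 1" "\<phi>' v \<le> p" using U by auto
      show "coarse_index k (k * (\<phi>' v - 1) + i + 1) = \<phi>' v"
        using coarse_index_eq_iff[OF k *(1)] that(2) by blast
    qed
    show "inj_on (\<lambda>(v, i). k * (\<phi>' v - 1) + i + 1)
      {w \<in> verts G \<times> {..<k}. fst w \<in> \<Union> (ends G ` edges G)}"
    proof (rule inj_onI)
      fix w w'
      assume *: "w \<in> {w \<in> verts G \<times> {..<k}. fst w \<in> \<Union> (ends G ` edges G)}"
        "w' \<in> {w \<in> verts G \<times> {..<k}. fst w \<in> \<Union> (ends G ` edges G)}"
        "(\<lambda>(v, i). k * (\<phi>' v - 1) + i + 1) w = (\<lambda>(v, i). k * (\<phi>' v - 1) + i + 1) w'"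
      obtain v i v' i' where w: "w = (v, i)" "w' = (v', i')" by fastforce
      have v: "v \<in> verts G" "i < k" "v' \<in> verts G" "i' < k"
        and eq: "k * (\<phi>' v - 1) + i + 1 = k * (\<phi>' v' - 1) + i' + 1"
        using * by (auto simp: w)
      have "\<phi>' v = \<phi>' v'" using idx(1)[of v i] idx(1)[of v' i'] v eq by simp
      moreover from this have "v = v'"
        using **(1) v by (auto simp: bij_betw_def inj_on_def)
      ultimately show "w = w'" using eq by (simp add: w)
    qed
    show "(case w of (v, i) \<Rightarrow> k * (\<phi>' v - 1) + i + 1) \<in> {1..k * p} \<and>
        coarse_index k (case w of (v, i) \<Rightarrow> k * (\<phi>' v - 1) + i + 1) = \<phi>' (fst w)"
      if w_in: "w \<in> verts G \<times> {..<k}" "fst w \<in> \<Union> (ends G ` edges G)" for w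
    proof -
      obtain v i where w: "w = (v, i)" "v \<in> verts G" "i < k" using w_in(1) by auto
      have "coarse_index k (k * (\<phi>' v - 1) + i + 1) \<le> p"
        using idx[OF w(2,3)] by simp
      then have "k * (\<phi>' v - 1) + i + 1 \<le> k * p"
        by (simp only: coarse_index_le_iff[OF k])
      then show ?thesis
        using idx(1)[OF w(2,3)] by (simp add: w(1))
    qed
  qed (use ** in auto)
  ultimately show ?thesis by (simp add: lift_count_def)
qed

text \<open>Fixed representatives of the reduced classes make the coefficient a function of those
  classes alone; what remains is to count the lifts that fall into a given class.\<close>

lemma coordinate_refine:
  assumes \<Lambda>: "\<Lambda> \<in> functionals n" and k: "k \<ge> 1" and p: "p \<ge> 2" and g: "g \<in> classes_on n p"
  shows "coordinate n p \<Lambda> g = (\<Sum>h\<in>classes_on n (k * p).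
    real (lift_count k (SOME G. G \<in> reduced_class g) (SOME H. H \<in> reduced_class h))
      * coordinate n (k * p) \<Lambda> h)"
proof -
  obtain L where L: "L \<in> {1..n} \<rightarrow>\<^sub>E vertex_pairs p" "g = iso_class (labelled_graph n p L)"
    using g by (rule classes_onE)
  have L': "L \<in> {1..n} \<rightarrow> vertex_pairs p" using L by auto
  have kp: "k * p > 0" using k p by simp
  define R where "R = (SOME G. G \<in> reduced_class g)"
  have mgL: "multigraph (labelled_graph n p L)" by (rule multigraph_labelled_graph[OF L'])
  have some_reduced: "multigraph (SOME H. H \<in> reduced_class (iso_class G))"
      "multigraph_iso (remove_isolated G) (SOME H. H \<in> reduced_class (iso_class G))"
    if "multigraph G" for G
  proof -
    have "(SOME H. H \<in> reduced_class (iso_class G)) \<in> iso_class (remove_isolated G)"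
      unfolding reduced_class_iso_class[OF that]
      using iso_class_self[OF multigraph_remove_isolated[OF that]] by (metis someI)
    then show "multigraph (SOME H. H \<in> reduced_class (iso_class G))"
      "multigraph_iso (remove_isolated G) (SOME H. H \<in> reduced_class (iso_class G))"
      by (auto simp: iso_class_def)
  qed
  have R: "multigraph R" "multigraph_iso (remove_isolated (labelled_graph n p L)) R"
    using some_reduced[OF mgL] by (simp_all add: R_def L(2))
  define F where "F = edge_lifts (coarse_index k) {1..k * p} (labelled_graph n p L)"
  define c where "c K = iso_class (labelled_graph n (k * p) K)" for K
  have F: "K \<in> {1..n} \<rightarrow>\<^sub>E vertex_pairs (k * p)" if "K \<in> F" for K
    using that by (auto simp: F_def edge_lifts_def labelled_graph_def vertex_pairs_def PiE_iff
        simp del: atLeastAtMost_iff)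
  have F': "K \<in> {1..n} \<rightarrow> vertex_pairs (k * p)" if "K \<in> F" for K using F[OF that] by auto
  have finF: "finite F" by (auto simp: F_def labelled_graph_def intro: finite_edge_lifts)
  have count: "card {K \<in> F. c K = h} = lift_count k R (SOME H. H \<in> reduced_class h)"
    if h: "h \<in> classes_on n (k * p)" for h
  proof -
    obtain J where J: "J \<in> {1..n} \<rightarrow>\<^sub>E vertex_pairs (k * p)"
      "h = iso_class (labelled_graph n (k * p) J)" using h by (rule classes_onE)
    have mgJ: "multigraph (labelled_graph n (k * p) J)"
      using J(1) by (intro multigraph_labelled_graph) auto
    define H where "H = (SOME H. H \<in> reduced_class h)"
    have H: "multigraph H" "multigraph_iso (remove_isolated (labelled_graph n (k * p) J)) H"
      using some_reduced[OF mgJ] by (simp_all add: H_def J(2))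
    have "c K = h \<longleftrightarrow> multigraph_iso (spanned_graph {1..n} K) H" if K: "K \<in> F" for K
    proof -
      have mgK: "multigraph (labelled_graph n (k * p) K)"
        by (rule multigraph_labelled_graph[OF F'[OF K]])
      have "c K = h \<longleftrightarrow> multigraph_iso (labelled_graph n (k * p) K) (labelled_graph n (k * p) J)"
        unfolding c_def J(2) by (rule iso_class_eq_iff[OF mgK mgJ])
      \<comment> \<open>Both graphs have \<open>k * p\<close> vertices, so discarding isolated ones
        loses nothing.\<close>
      also have "\<dots> \<longleftrightarrow> multigraph_iso (remove_isolated (labelled_graph n (k * p) K))
          (remove_isolated (labelled_graph n (k * p) J))"
        using remove_isolated_iso[OF mgK mgJ] iso_if_remove_isolated_iso[OF mgK mgJ]
        by (auto simp: labelled_graph_def)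
      also have "\<dots> \<longleftrightarrow> multigraph_iso (remove_isolated (labelled_graph n (k * p) K)) H"
        using H(2) multigraph_iso_trans multigraph_iso_sym multigraph_remove_isolated[OF mgJ]
        by blast
      finally show ?thesis by (simp only: remove_isolated_labelled_graph[OF F'[OF K]])
    qed
    then have "{K \<in> F. c K = h} = {K \<in> F. multigraph_iso (spanned_graph {1..n} K) H}"
      by blast
    then show ?thesis
      using card_labelled_lifts[OF k L' R, of H] by (simp add: F_def H_def)
  qed
  have "coordinate n p \<Lambda> g = \<Lambda> (block_tuple n p L)"
    unfolding L(2) using p by (intro coordinate_labelled_graph \<Lambda> L) simp
  also have "\<dots> = (\<Sum>K\<in>F. \<Lambda> (block_tuple n (k * p) K))"
    unfolding F_def by (rule block_tuple_refine[OF \<Lambda> k L(1)])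
  also have "\<dots> = (\<Sum>K\<in>F. coordinate n (k * p) \<Lambda> (c K))"
    unfolding c_def using coordinate_labelled_graph[OF \<Lambda> kp F] by simp
  \<comment> \<open>Lifts are grouped by class. The coordinate is constant on a group, which leaves
    the size of the group as a factor.\<close>
  also have "\<dots> = (\<Sum>h\<in>classes_on n (k * p). \<Sum>K | K \<in> F \<and> c K = h. coordinate n (k * p) \<Lambda> (c K))"
    using finF finite_classes_on labelled_graph_class[OF F']
    by (intro sum.group[symmetric]) (auto simp: c_def)
  also have "\<dots> = (\<Sum>h\<in>classes_on n (k * p).
      real (lift_count k R (SOME H. H \<in> reduced_class h)) * coordinate n (k * p) \<Lambda> h)"
    using count by (intro sum.cong) auto
  finally show ?thesis by (simp only: R_def)
qed

text \<open>The chosen member is known only to be isomorphic to a graph without isolated vertices.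
  Counting shows that its reduction keeps all of its vertices.\<close>

lemma classes_some:
  assumes "g \<in> classes n"
  shows "(SOME G. G \<in> g) \<in> g" "multigraph (SOME G. G \<in> g)" "isolated_verts (SOME G. G \<in> g) = {}"
proof -
  obtain G where G: "multigraph G" "isolated_verts G = {}" "g = iso_class G"
    using assms by (auto simp: classes_def)
  define G' where "G' = (SOME G. G \<in> g)"
  show g: "(SOME G. G \<in> g) \<in> g"
    using iso_class_self[OF G(1)] unfolding G(3) by (rule someI)
  then have G': "multigraph G'" "multigraph_iso G G'"
    by (auto simp: G(3) G'_def iso_class_def)
  then show "multigraph (SOME G. G \<in> g)" by (simp add: G'_def)
  have "card (verts (remove_isolated G)) = card (verts (remove_isolated G'))"
    using remove_isolated_iso[OF G(1) G'] by (rule multigraph_iso_card)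
  then have "card (verts G') = card (verts G' - isolated_verts G')"
    using G(2) multigraph_iso_card(1)[OF G'(2)] by (simp add: remove_isolated_def)
  then have "verts G' - isolated_verts G' = verts G'"
    using G'(1) by (intro card_subset_eq) (auto simp: multigraph_def)
  then show "isolated_verts (SOME G. G \<in> g) = {}"
    by (auto simp: isolated_verts_def G'_def)
qed

theorem theorem3p9:
  fixes n k :: nat
  assumes "n \<ge> 1" and "k \<ge> 1"
  shows "\<exists>\<pi> :: graph set \<Rightarrow> graph set \<Rightarrow> nat.
    (\<forall>p\<ge>2. \<forall>\<Lambda>\<in>functionals n. \<forall>g\<in>classes_on n p.
        coordinate n p \<Lambda> g =
          (\<Sum>h\<in>classes_on n (k * p).
             real (\<pi> (reduced_class g) (reduced_class h)) * coordinate n (k * p) \<Lambda> h)) \<and>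
    (\<forall>g\<in>classes n. \<forall>h\<in>classes n. \<pi> g h \<noteq> 0 \<longrightarrow>
        (\<exists>H\<in>h. \<exists>G\<in>g. surjects_onto H G)) \<and>
    (\<forall>g\<in>classes n. \<pi> g g > 0)"
proof (intro exI[of _ "\<lambda>g h. lift_count k (SOME G. G \<in> g) (SOME H. H \<in> h)"] conjI ballI allI impI)
  show "coordinate n p \<Lambda> g = (\<Sum>h\<in>classes_on n (k * p).
      real (lift_count k (SOME G. G \<in> reduced_class g) (SOME H. H \<in> reduced_class h))
        * coordinate n (k * p) \<Lambda> h)"
    if "p \<ge> 2" "\<Lambda> \<in> functionals n" "g \<in> classes_on n p" for p \<Lambda> g
    using that assms(2) by (intro coordinate_refine)
  show "\<exists>H\<in>h. \<exists>G\<in>g. surjects_onto H G"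
    if "g \<in> classes n" "h \<in> classes n" "lift_count k (SOME G. G \<in> g) (SOME H. H \<in> h) \<noteq> 0" for g h
    using lift_count_surjects_onto[OF classes_some(2,3)[OF that(1)] that(3)]
      classes_some(1)[OF that(1)] classes_some(1)[OF that(2)] by blast
  show "lift_count k (SOME G. G \<in> g) (SOME G. G \<in> g) > 0" if "g \<in> classes n" for g
    by (rule lift_count_self_pos[OF classes_some(2,3)[OF that] assms(2) multigraph_iso_refl])
qed

end
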